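(* Let $N\ge1$, $\sigma\in(0,1]$, $n>0$, $m>1$. There exists $\alpha_0=\alpha_0(n,\sigma,m)<1$ such that the following holds. Let $T>0$, $Q_T=\mathbb{R}^N\times(0,T]$, $\bar Q_T=\mathbb{R}^N\times[0,T]$. Let $K^\sigma:\mathbb{R}^N\to\mathbb{R}$ be nonnegative and measurable and such that $\bar k(z):=K^\sigma(z)|z|^{N+\sigma}$ is bounded on $\mathbb{R}^N$, continuous at the origin, with $\bar k(0)>0$. Let $F\in C(\mathbb{R}^N\times\mathbb{R}^N\times\mathbb{R})$ be degenerate elliptic in the nonlocal variable, i.e. $F(x,p,l_1)\le F(x,p,l_2)$ whenever $l_1\ge l_2$, and suppose there is a modulus of continuity $\omega$ such that for all $x_i,p_i\in\mathbb{R}^N$, $l_i\in\mathbb{R}$, $i=1,2$, $$|F(x_1,p_1,l_1)-F(x_2,p_2,l_2)|\le\omega\Big(|l_1-l_2|+|x_1-x_2|(1+|l|+|p|^m)^n+|p_1-p_2|(1+|l|+|p|^m)^n\Big),$$ where $|p|=\max\{|p_1|,|p_2|\}$ and $|l|=\max\{|l_1|,|l_2|\}$. Let $u,v$ be bounded functions on $\bar Q_T$, with $u$ upper semicontinuous and $v$ lower semicontinuous in $\bar Q_T$, which are respectively a viscosity subsolution and a viscosity supersolution of $$u_t+F(x,Du,\mathcal{I}(u,x))=0\quad\text{in }Q_T.$$ Assume that $u\le v$ in $\mathbb{R}^N\times[0,d_0]$ for some $0<d_0<T$. If $u$ or $v$ belongs to $C^\alpha(\bar Q_T)$ for some $\alpha\in(\alpha_0,1)$,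 then $u\le v$ in $\bar Q_T$.
   Context: A modulus of continuity is a nondecreasing function $\omega:[0,\infty)\to[0,\infty)$ with $\omega(t)\to\omega(0)=0$ as $t\to0^+$. $C^\alpha(\bar Q_T)$ is the space of bounded functions that are (globally) $\alpha$-Hölder continuous in $(x,t)$. $B_\delta$ is the ball of radius $\delta$ centered at $0$, $B_\delta(x)$ the ball centered at $x$, $B=B_1$. Set $\mathbb{I}_\sigma=1$ if $\sigma=1$ and $\mathbb{I}_\sigma=0$ if $\sigma<1$. The nonlocal operator, acting in the space variable at fixed time, is $$\mathcal{I}(u,x)=\int_{\mathbb{R}^N}[u(x+z)-u(x)-\mathbb{I}_\sigma\mathbf 1_B(z)\langle Du(x),z\rangle]K^\sigma(z)\,dz .$$ Viscosity semisolutions. For $\delta\in(0,1)$, $\phi\in C^2$, bounded $u$ and $p\in\mathbb{R}^N$ set $\mathcal{I}[B_\delta](\phi,x)=\int_{B_\delta}[\phi(x+z,t)-\phi(x,t)-\mathbb{I}_\sigma\langle D\phi(x,t),z\rangle]K^\sigma(z)dz$ and $\mathcal{I}[B_\delta^c](u,p,x)=\int_{B_\delta^c}[u(x+z,t)-u(x,t)-\mathbb{I}_\sigma\mathbf 1_B(z)\langle p,z\rangle]K^\sigma(z)dz$. A bounded upper semicontinuous (resp. lower semicontinuous) function $u$ is a viscosity subsolution (resp. supersolution) of $u_t+F(x,Du,\mathcal{I}(u,x))=0$ in $Q_T$ if for every $(x,t)\in\mathbb{R}^N\times(0,T]$ and every $\phi\in C^2(\mathbb{R}^N\times(0,T])$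 such that $(x,t)$ is a maximum (resp. minimum) point of $u-\phi$ in $B_\delta(x)\times(t-\delta,t+\delta)$ (intersected with $Q_T$) for a small $\delta>0$, one has $$\phi_t(x,t)+F\big(x,D\phi(x,t),\mathcal{I}[B_\delta](\phi,x)+\mathcal{I}[B_\delta^c](u,D\phi(x,t),x)\big)\le0\quad(\text{resp. }\ge0).$$ *)

theory Defs
  imports "HOL-Analysis.Analysis" "HOL-Library.Function_Algebras"
begin

text \<open>
  The threshold exponent must not depend on the dimension \<open>N\<close>, so \<open>N\<close> is a number quantified
  inside the statement rather than an index type. As in the library's \<^const>\<open>Euclidean_space\<close>,
  \<open>\<real>\<^sup>N\<close> is the set of real sequences vanishing from index \<open>N\<close> on. The product topology of
  \<^typ>\<open>nat \<Rightarrow> real\<close> induces the Euclidean topology on it, so \<^const>\<open>continuous_on\<close>, \<^const>\<open>openin\<close>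
  and limits can be used as they are. The metric \<^const>\<open>dist\<close> of \<^typ>\<open>nat \<Rightarrow> real\<close> is not the
  Euclidean one; distances are always measured by \<open>norm_RN\<close> below.
\<close>

type_synonym vec = "nat \<Rightarrow> real"
type_synonym point = "vec \<times> real"

definition RN :: "nat \<Rightarrow> vec set" where
  "RN N = {x. \<forall>i\<ge>N. x i = 0}"

lemma Euclidean_space_eq_top_of_set_RN: "Euclidean_space N = top_of_set (RN N)"
  by (simp add: Euclidean_space_def RN_def euclidean_product_topology)

definition inner_RN :: "nat \<Rightarrow> vec \<Rightarrow> vec \<Rightarrow> real" where
  "inner_RN N x y = (\<Sum>i<N. x i * y i)"

definition norm_RN :: "nat \<Rightarrow> vec \<Rightarrow> real" where
  "norm_RN N x = L2_set x {..<N}"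

definition ball_RN :: "nat \<Rightarrow> vec \<Rightarrow> real \<Rightarrow> vec set" where
  "ball_RN N x r = {y \<in> RN N. norm_RN N (y - x) < r}"

text \<open>
  Lebesgue measure on \<open>\<real>\<^sup>N\<close>, as a complete measure on all sequences that is concentrated on
  \<open>RN N\<close>.
\<close>

definition lebesgue_RN :: "nat \<Rightarrow> vec measure" where
  "lebesgue_RN N =
     completion (distr (Pi\<^sub>M {..<N} (\<lambda>_. lborel)) borel (\<lambda>z i. if i < N then z i else 0))"

definition QT :: "nat \<Rightarrow> real \<Rightarrow> point set" where
  "QT N T = RN N \<times> {0<..T}"

definition QT_bar :: "nat \<Rightarrow> real \<Rightarrow> point set" where
  "QT_bar N T = RN N \<times> {0..T}"

definition usc_on :: "'a::topological_space set \<Rightarrow> ('a \<Rightarrow> real) \<Rightarrow> bool" where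
  "usc_on S f \<longleftrightarrow> (\<forall>c. openin (top_of_set S) {q \<in> S. f q < c})"

definition lsc_on :: "'a::topological_space set \<Rightarrow> ('a \<Rightarrow> real) \<Rightarrow> bool" where
  "lsc_on S f \<longleftrightarrow> (\<forall>c. openin (top_of_set S) {q \<in> S. c < f q})"

definition modulus_of_continuity :: "(real \<Rightarrow> real) \<Rightarrow> bool" where
  "modulus_of_continuity \<omega> \<longleftrightarrow>
     mono_on {0..} \<omega> \<and> (\<forall>t\<ge>0. 0 \<le> \<omega> t) \<and> \<omega> 0 = 0 \<and> (\<omega> \<longlongrightarrow> 0) (at_right 0)"

definition Holder_QT_bar :: "nat \<Rightarrow> real \<Rightarrow> real \<Rightarrow> (point \<Rightarrow> real) \<Rightarrow> bool" where
  "Holder_QT_bar N T \<alpha> f \<longleftrightarrow>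
     bounded (f ` QT_bar N T) \<and>
     (\<exists>C. \<forall>(x, t) \<in> QT_bar N T. \<forall>(y, s) \<in> QT_bar N T.
        \<bar>f (x, t) - f (y, s)\<bar> \<le> C * sqrt ((norm_RN N (x - y))\<^sup>2 + (t - s)\<^sup>2) powr \<alpha>)"

text \<open>
  \<open>C1_QT N T f Df ft\<close>: \<open>f\<close> is \<open>C\<^sup>1\<close> on \<open>\<real>\<^sup>N \<times> (0,T]\<close> with spatial gradient \<open>Df\<close> and time derivative
  \<open>ft\<close>; the time derivative at \<open>t = T\<close> is one-sided.
\<close>

definition C1_QT ::
  "nat \<Rightarrow> real \<Rightarrow> (point \<Rightarrow> real) \<Rightarrow> (point \<Rightarrow> vec) \<Rightarrow> (point \<Rightarrow> real) \<Rightarrow> bool" where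
  "C1_QT N T f Df ft \<longleftrightarrow>
     continuous_on (QT N T) f \<and> continuous_on (QT N T) Df \<and> continuous_on (QT N T) ft \<and>
     (\<forall>(x, t) \<in> QT N T.
        Df (x, t) \<in> RN N \<and>
        (\<forall>i<N. ((\<lambda>h. f (x(i := h), t)) has_real_derivative Df (x, t) i) (at (x i))) \<and>
        ((\<lambda>s. f (x, s)) has_real_derivative ft (x, t)) (at t within {0<..T}))"

definition C2_QT ::
  "nat \<Rightarrow> real \<Rightarrow> (point \<Rightarrow> real) \<Rightarrow> (point \<Rightarrow> vec) \<Rightarrow> (point \<Rightarrow> real) \<Rightarrow> bool" where
  "C2_QT N T f Df ft \<longleftrightarrow>
     C1_QT N T f Df ft \<and>
     (\<forall>i<N. \<exists>g gt. C1_QT N T (\<lambda>q. Df q i) g gt) \<and>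
     (\<exists>g gt. C1_QT N T ft g gt)"

definition I_ind :: "real \<Rightarrow> real" where
  "I_ind \<sigma> = (if \<sigma> = 1 then 1 else 0)"

definition I_near ::
  "nat \<Rightarrow> real \<Rightarrow> (vec \<Rightarrow> real) \<Rightarrow> real \<Rightarrow> (point \<Rightarrow> real) \<Rightarrow> vec \<Rightarrow> vec \<Rightarrow> real \<Rightarrow> real" where
  "I_near N \<sigma> K \<delta> \<phi> p x t =
     (LINT z:ball_RN N 0 \<delta>|lebesgue_RN N.
        (\<phi> (x + z, t) - \<phi> (x, t) - I_ind \<sigma> * inner_RN N p z) * K z)"

definition I_far ::
  "nat \<Rightarrow> real \<Rightarrow> (vec \<Rightarrow> real) \<Rightarrow> real \<Rightarrow> (point \<Rightarrow> real) \<Rightarrow> vec \<Rightarrow> vec \<Rightarrow> real \<Rightarrow> real" where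
  "I_far N \<sigma> K \<delta> u p x t =
     (LINT z:RN N - ball_RN N 0 \<delta>|lebesgue_RN N.
        (u (x + z, t) - u (x, t)
           - I_ind \<sigma> * indicator (ball_RN N 0 1) z * inner_RN N p z) * K z)"

definition test_nbhd :: "nat \<Rightarrow> real \<Rightarrow> vec \<Rightarrow> real \<Rightarrow> real \<Rightarrow> point set" where
  "test_nbhd N T x t \<delta> = (ball_RN N x \<delta> \<times> {t - \<delta><..<t + \<delta>}) \<inter> QT N T"

definition viscosity_subsolution ::
  "nat \<Rightarrow> real \<Rightarrow> (vec \<Rightarrow> real) \<Rightarrow> (vec \<Rightarrow> vec \<Rightarrow> real \<Rightarrow> real) \<Rightarrow> real \<Rightarrow> (point \<Rightarrow> real) \<Rightarrow> bool"
where
  "viscosity_subsolution N \<sigma> K F T u \<longleftrightarrow>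
     bounded (u ` QT N T) \<and> usc_on (QT N T) u \<and>
     (\<forall>(x, t) \<in> QT N T. \<forall>\<phi> D\<phi> \<phi>t. \<forall>\<delta>\<in>{0<..<1}.
        C2_QT N T \<phi> D\<phi> \<phi>t \<longrightarrow>
        (\<forall>q \<in> test_nbhd N T x t \<delta>. u q - \<phi> q \<le> u (x, t) - \<phi> (x, t)) \<longrightarrow>
        \<phi>t (x, t) + F x (D\<phi> (x, t))
          (I_near N \<sigma> K \<delta> \<phi> (D\<phi> (x, t)) x t + I_far N \<sigma> K \<delta> u (D\<phi> (x, t)) x t) \<le> 0)"

definition viscosity_supersolution ::
  "nat \<Rightarrow> real \<Rightarrow> (vec \<Rightarrow> real) \<Rightarrow> (vec \<Rightarrow> vec \<Rightarrow> real \<Rightarrow> real) \<Rightarrow> real \<Rightarrow> (point \<Rightarrow> real) \<Rightarrow> bool"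
where
  "viscosity_supersolution N \<sigma> K F T v \<longleftrightarrow>
     bounded (v ` QT N T) \<and> lsc_on (QT N T) v \<and>
     (\<forall>(x, t) \<in> QT N T. \<forall>\<phi> D\<phi> \<phi>t. \<forall>\<delta>\<in>{0<..<1}.
        C2_QT N T \<phi> D\<phi> \<phi>t \<longrightarrow>
        (\<forall>q \<in> test_nbhd N T x t \<delta>. v (x, t) - \<phi> (x, t) \<le> v q - \<phi> q) \<longrightarrow>
        \<phi>t (x, t) + F x (D\<phi> (x, t))
          (I_near N \<sigma> K \<delta> \<phi> (D\<phi> (x, t)) x t + I_far N \<sigma> K \<delta> v (D\<phi> (x, t)) x t) \<ge> 0)"

text \<open>
  The function \<open>K z * |z|\<^bsup>N+\<sigma>\<^esup>\<close> takes the value 0 at \<open>z = 0\<close> as a formula; its continuity at the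
  origin with a positive value there refers to its continuous extension, i.e. to a positive
  limit at the origin.
\<close>

definition admissible_kernel :: "nat \<Rightarrow> real \<Rightarrow> (vec \<Rightarrow> real) \<Rightarrow> bool" where
  "admissible_kernel N \<sigma> K \<longleftrightarrow>
     (\<forall>z\<in>RN N. 0 \<le> K z) \<and>
     K \<in> borel_measurable (lebesgue_RN N) \<and>
     bounded ((\<lambda>z. K z * norm_RN N z powr (real N + \<sigma>)) ` RN N) \<and>
     (\<exists>k0>0. ((\<lambda>z. K z * norm_RN N z powr (real N + \<sigma>)) \<longlongrightarrow> k0) (at 0 within RN N))"

definition degenerate_elliptic :: "nat \<Rightarrow> (vec \<Rightarrow> vec \<Rightarrow> real \<Rightarrow> real) \<Rightarrow> bool" where
  "degenerate_elliptic N F \<longleftrightarrow>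
     (\<forall>x\<in>RN N. \<forall>p\<in>RN N. \<forall>l1 l2. l1 \<ge> l2 \<longrightarrow> F x p l1 \<le> F x p l2)"

definition structure_condition ::
  "nat \<Rightarrow> real \<Rightarrow> real \<Rightarrow> (real \<Rightarrow> real) \<Rightarrow> (vec \<Rightarrow> vec \<Rightarrow> real \<Rightarrow> real) \<Rightarrow> bool" where
  "structure_condition N n m \<omega> F \<longleftrightarrow>
     (\<forall>x1\<in>RN N. \<forall>x2\<in>RN N. \<forall>p1\<in>RN N. \<forall>p2\<in>RN N. \<forall>l1 l2.
        let P = max (norm_RN N p1) (norm_RN N p2);
            L = max \<bar>l1\<bar> \<bar>l2\<bar>
        in \<bar>F x1 p1 l1 - F x2 p2 l2\<bar> \<le>
             \<omega> (\<bar>l1 - l2\<bar> + norm_RN N (x1 - x2) * (1 + L + P powr m) powr n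
                  + norm_RN N (p1 - p2) * (1 + L + P powr m) powr n))"

end

theory Submission
  imports Defs
begin

text \<open>
  Doubling of variables: maximise
  \<open>u(x,t) - v(y,s) - (|x-y|\<^sup>2 + (t-s)\<^sup>2)/\<epsilon> - \<eta>t\<close>, up to bumps of size \<open>\<beta>\<close> that make the
  maximum exist.
  If \<open>u\<close> or \<open>v\<close> is \<open>\<alpha>\<close>-Hoelder, the maximum satisfies \<open>|x-y| \<le> C\<epsilon>\<^sup>\<alpha>\<close>, so the gradients
  are \<open>O(\<epsilon>\<^bsup>\<alpha>-1\<^esup>)\<close>. Splitting the nonlocal terms at the radius \<open>\<delta> = \<epsilon>\<^sup>A\<close> with \<open>A\<close> large, the parts
  inside are \<open>O(\<epsilon>)\<close>, the outer part of the Hoelder function blows up like a small negative power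
  of \<open>\<epsilon>\<close>, and the outer parts are ordered up to \<open>O(\<epsilon>)\<close> by maximality. Only the nonlocal term of
  the Hoelder function has to be bounded, because ellipticity replaces the other one by it. For
  \<open>\<alpha>\<close> close to 1 the argument of \<open>\<omega>\<close> in the structure condition is then \<open>O(\<epsilon>\<^bsup>1/4\<^esup>)\<close>, while the
  two viscosity inequalities force \<open>\<eta> \<le> \<omega>(C\<epsilon>\<^bsup>1/4\<^esup>)\<close>.
\<close>

section \<open>Euclidean space and Lebesgue measure on sequences\<close>

text \<open>The obstacle is the factor (1 + |l| + |p|^m)^n. For merely bounded functions the
  nonlocal term outside the ball of radius \<delta> is controlled only by \<delta>^(-\<sigma>),
  whose n-th power can outweigh the decay of |x - y|. The radius cannot be kept large either: the
  test functions have second derivatives of order 1/\<epsilon>, and inside the ball their integrand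
  is of second order in z if \<sigma> = 1 but, without compensator, of first order if \<sigma> < 1.
  Hence \<delta>^(1 + I - \<sigma>) = \<epsilon>^2, with I the indicator of \<sigma> = 1, which
  fixes A = 2 / (1 + I - \<sigma>). Treating the Hoelder function as one of exponent \<sigma> -
  \<kappa> turns \<delta>^(-\<sigma>) into \<delta>^(-\<kappa>), and \<kappa> is free: it is taken
  so small that the growth exponent n (A + 1 + m) \<kappa> is at most 1/4, and the threshold is 1 -
  \<kappa>. The dimension enters constants but no exponent, so the threshold is independent of N.
  Since F does not involve time, t - s needs no rate; Hoelder continuity in time only keeps both
  times of the maximum positive, where the viscosity inequalities are available.\<close>

lemma norm_RN_nonneg [simp]: "0 \<le> norm_RN N x"
  by (simp add: norm_RN_def)

lemma norm_RN_zero [simp]: "norm_RN N 0 = 0"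
  by (simp add: norm_RN_def L2_set_def)

lemma norm_RN_power2: "(norm_RN N x)\<^sup>2 = (\<Sum>i<N. (x i)\<^sup>2)"
  by (simp add: norm_RN_def L2_set_def sum_nonneg)

lemma norm_RN_eq_0_iff:
  assumes "x \<in> RN N"
  shows "norm_RN N x = 0 \<longleftrightarrow> x = 0"
proof
  assume "norm_RN N x = 0"
  then have "\<forall>i<N. x i = 0"
    by (simp add: norm_RN_def L2_set_eq_0_iff)
  with assms show "x = 0"
    by (auto simp: RN_def fun_eq_iff) (metis not_le)
qed simp

lemma abs_component_le_norm_RN: "i < N \<Longrightarrow> \<bar>x i\<bar> \<le> norm_RN N x"
  using member_le_L2_set[of "{..<N}" i "\<lambda>i. \<bar>x i\<bar>"] by (simp add: norm_RN_def L2_set_def)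

lemma norm_RN_triangle: "norm_RN N (x + y) \<le> norm_RN N x + norm_RN N y"
  using L2_set_triangle_ineq[of x y "{..<N}"]
  by (simp add: norm_RN_def plus_fun_def)

lemma norm_RN_minus_commute: "norm_RN N (x - y) = norm_RN N (y - x)"
  by (simp add: norm_RN_def L2_set_def power2_commute)

lemma norm_RN_minus [simp]: "norm_RN N (- x) = norm_RN N x"
  by (simp add: norm_RN_def L2_set_def)

lemma norm_RN_le_sum_abs: "norm_RN N x \<le> (\<Sum>i<N. \<bar>x i\<bar>)"
  unfolding norm_RN_def by (rule L2_set_le_sum_abs)

lemma abs_inner_RN_le: "\<bar>inner_RN N x y\<bar> \<le> norm_RN N x * norm_RN N y"
proof -
  have "\<bar>inner_RN N x y\<bar> \<le> (\<Sum>i<N. \<bar>x i\<bar> * \<bar>y i\<bar>)"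
    unfolding inner_RN_def by (rule order_trans[OF sum_abs]) (simp add: abs_mult)
  also have "\<dots> \<le> norm_RN N x * norm_RN N y"
    unfolding norm_RN_def by (rule L2_set_mult_ineq)
  finally show ?thesis .
qed

lemma RN_closed_add: "x \<in> RN N \<Longrightarrow> y \<in> RN N \<Longrightarrow> x + y \<in> RN N"
  and RN_closed_minus: "x \<in> RN N \<Longrightarrow> - x \<in> RN N"
  and zero_in_RN: "0 \<in> RN N"
  by (simp_all add: RN_def)

lemma continuous_on_coordinate: "continuous_on S (\<lambda>x::vec. x i)"
  by (rule continuous_on_subset[OF continuous_on_product_coordinates subset_UNIV])

lemma closed_RN: "closed (RN N)"
proof -
  have "RN N = (\<Inter>i\<in>{N..}. {x. x i = 0})"
    by (auto simp: RN_def)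
  moreover have "closed {x::vec. x i = 0}" for i
    by (intro closed_Collect_eq continuous_on_coordinate continuous_on_const)
  ultimately show ?thesis
    by auto
qed

lemma continuous_on_norm_RN: "continuous_on S (norm_RN N)"
  unfolding norm_RN_def[abs_def] L2_set_def
  by (intro continuous_intros continuous_on_coordinate)

section \<open>Measurability and the volume of balls\<close>

lemma space_lebesgue_RN [simp]: "space (lebesgue_RN N) = UNIV"
  by (simp add: lebesgue_RN_def)

lemma sets_borel_lebesgue_RN: "A \<in> sets borel \<Longrightarrow> A \<in> sets (lebesgue_RN N)"
  by (simp add: lebesgue_RN_def sets_completionI_sets)

lemma borel_measurable_lebesgue_RN:
  assumes "f \<in> borel_measurable borel"
  shows "f \<in> borel_measurable (lebesgue_RN N)"
  unfolding lebesgue_RN_def by (rule measurable_completion) (use assms in simp)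

lemma norm_RN_measurable [measurable]: "norm_RN N \<in> borel_measurable (lebesgue_RN N)"
  by (intro borel_measurable_lebesgue_RN borel_measurable_continuous_onI continuous_on_norm_RN)

lemma RN_sets [measurable]: "RN N \<in> sets (lebesgue_RN N)"
  by (intro sets_borel_lebesgue_RN borel_closed closed_RN)

lemma ball_RN_sets [measurable]: "ball_RN N 0 r \<in> sets (lebesgue_RN N)"
proof -
  have "ball_RN N 0 r = RN N \<inter> {z \<in> space (lebesgue_RN N). norm_RN N z < r}"
    by (auto simp: ball_RN_def)
  also have "\<dots> \<in> sets (lebesgue_RN N)"
    by measurable
  finally show ?thesis .
qed

lemma inner_RN_measurable [measurable]: "inner_RN N p \<in> borel_measurable (lebesgue_RN N)"
  unfolding inner_RN_def[abs_def]
  by (intro borel_measurable_lebesgue_RN borel_measurable_continuous_onI continuous_intros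
        continuous_on_coordinate)

text \<open>The ball lies in a cube of side 2 r. Only the power of r matters later, where it cancels
  the dimension in the singularity of the kernel; the sharp volume is irrelevant.\<close>

lemma emeasure_ball_RN_le:
  assumes "0 \<le> r"
  shows "emeasure (lebesgue_RN N) (ball_RN N 0 r) \<le> ennreal ((2 * r) ^ N)"
proof -
  interpret product_sigma_finite "\<lambda>_::nat. lborel :: real measure"
    by standard
  \<comment> \<open>Zero padding: the map along which \<open>lebesgue_RN\<close> pushes the product
    measure forward.\<close>
  define e where "e = (\<lambda>(z::vec) i. if i < N then z i else 0)"
  have e: "e \<in> measurable (Pi\<^sub>M {..<N} (\<lambda>_. lborel)) borel"
  proof (rule measurable_coordinatewise_then_product)
    fix i
    show "(\<lambda>z. e z i) \<in> measurable (Pi\<^sub>M {..<N} (\<lambda>_. lborel)) borel"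
      by (cases "i < N") (simp_all add: e_def)
  qed
  have B: "ball_RN N 0 r \<in> sets borel"
  proof -
    have "ball_RN N 0 r = RN N \<inter> {z. norm_RN N z < r}"
      by (auto simp: ball_RN_def)
    moreover have "open {z. norm_RN N z < r}"
      by (intro open_Collect_less continuous_on_norm_RN continuous_on_const)
    ultimately show ?thesis
      using closed_RN by auto
  qed
  have "emeasure (lebesgue_RN N) (ball_RN N 0 r)
      = emeasure (distr (Pi\<^sub>M {..<N} (\<lambda>_. lborel)) borel e) (ball_RN N 0 r)"
    unfolding lebesgue_RN_def e_def using B by (simp add: main_part_sets)
  also have "\<dots> = emeasure (Pi\<^sub>M {..<N} (\<lambda>_. lborel))
      (e -` ball_RN N 0 r \<inter> space (Pi\<^sub>M {..<N} (\<lambda>_. lborel)))"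
    by (rule emeasure_distr[OF e B])
  also have "\<dots> \<le> emeasure (Pi\<^sub>M {..<N} (\<lambda>_. lborel)) (Pi\<^sub>E {..<N} (\<lambda>_. {-r..r}))"
  proof (rule emeasure_mono)
    show "e -` ball_RN N 0 r \<inter> space (Pi\<^sub>M {..<N} (\<lambda>_. lborel)) \<subseteq> Pi\<^sub>E {..<N} (\<lambda>_. {-r..r})"
    proof
      fix z assume z: "z \<in> e -` ball_RN N 0 r \<inter> space (Pi\<^sub>M {..<N} (\<lambda>_. lborel))"
      then have "norm_RN N (e z) < r"
        by (simp add: ball_RN_def)
      then have "\<bar>z i\<bar> \<le> r" if "i < N" for i
        using abs_component_le_norm_RN[OF that, of "e z"] that by (simp add: e_def)
      with z show "z \<in> Pi\<^sub>E {..<N} (\<lambda>_. {-r..r})"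
        by (auto simp: space_PiM PiE_iff abs_le_iff minus_le_iff)
    qed
  qed (auto intro!: sets_PiM_I_finite)
  also have "\<dots> = (\<Prod>i<N. emeasure lborel {-r..r})"
    by (rule emeasure_PiM) auto
  also have "\<dots> = ennreal ((2 * r) ^ N)"
    using assms by (simp add: ennreal_power)
  finally show ?thesis .
qed

section \<open>Moments of the kernel\<close>

text \<open>On a dyadic shell every power is comparable to its value at the outer radius; for
  negative s the worst point is r = R / 2, which costs the factor 2^|s|.\<close>

lemma powr_le_dyadic:
  fixes r R s :: real
  assumes "0 < R" "R / 2 \<le> r" "r < R"
  shows "r powr s \<le> 2 powr \<bar>s\<bar> * R powr s"
proof (cases "0 \<le> s")
  case True
  have "r powr s \<le> 1 * R powr s"
    using assms True by (simp add: powr_mono2)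
  also have "\<dots> \<le> 2 powr \<bar>s\<bar> * R powr s"
    by (rule mult_right_mono) (simp_all add: ge_one_powr_ge_zero)
  finally show ?thesis .
next
  case False
  have "r powr s \<le> (R / 2) powr s"
    using assms False by (intro powr_mono2') auto
  also have "\<dots> = 2 powr \<bar>s\<bar> * R powr s"
    using assms False by (simp add: powr_divide powr_minus field_simps)
  finally show ?thesis .
qed

text \<open>A moment estimate that avoids polar coordinates. On the shell R_k / 2 \<le> |z| < R_k
  the kernel bound makes the integrand at most a constant times R_k^(q - N - \<sigma>), and the
  shell is enlarged to the whole ball, of measure at most (2 R_k)^N. The dimension cancels and
  R_k^(q - \<sigma>) remains. Shrinking and growing radii give the moments near and away from the
  origin.\<close>

lemma kernel_nn_integral_dyadic:
  fixes R :: "nat \<Rightarrow> real"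
  assumes K: "\<And>z. z \<in> RN N \<Longrightarrow> 0 \<le> K z"
    and Kb: "\<And>z. z \<in> RN N \<Longrightarrow> K z * norm_RN N z powr (real N + \<sigma>) \<le> Kb"
    and R: "\<And>k. 0 < R k"
    and S: "S \<subseteq> RN N"
    and cover: "\<And>z. z \<in> S \<Longrightarrow> z \<noteq> 0 \<Longrightarrow> \<exists>k. R k / 2 \<le> norm_RN N z \<and> norm_RN N z < R k"
  shows "(\<integral>\<^sup>+z. ennreal (indicator S z * (norm_RN N z powr q * K z)) \<partial>lebesgue_RN N)
     \<le> (\<Sum>k. ennreal (Kb * 2 powr \<bar>q - real N - \<sigma>\<bar> * 2 ^ N * R k powr (q - \<sigma>)))"
proof -
  define s where "s = q - real N - \<sigma>"
  \<comment> \<open>At the origin \<open>0 powr _\<close> is 0, so the kernel bound there reads 0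
    \<le> Kb.\<close>
  have Kb0: "0 \<le> Kb"
    using Kb[OF zero_in_RN] K[OF zero_in_RN] by simp
  define c where "c k = Kb * 2 powr \<bar>s\<bar> * R k powr s" for k
  have c0: "0 \<le> c k" for k
    using Kb0 by (simp add: c_def)
  define A where "A k = ball_RN N 0 (R k)" for k
  have pt: "ennreal (indicator S z * (norm_RN N z powr q * K z))
      \<le> (\<Sum>k. ennreal (c k) * indicator (A k) z)" for z
  proof (cases "z \<in> S \<and> z \<noteq> 0")
    case True
    then obtain k where k: "R k / 2 \<le> norm_RN N z" "norm_RN N z < R k"
      using cover by blast
    have z: "z \<in> RN N"
      using True S by auto
    have pos: "0 < norm_RN N z"
      using k R[of k] by linarith
    have "norm_RN N z powr q * K z
        = norm_RN N z powr s * (K z * norm_RN N z powr (real N + \<sigma>))"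
      using pos by (simp add: s_def powr_add[symmetric] mult.left_commute mult.assoc[symmetric])
    also have "\<dots> \<le> norm_RN N z powr s * Kb"
      by (intro mult_left_mono Kb z) simp
    also have "\<dots> \<le> (2 powr \<bar>s\<bar> * R k powr s) * Kb"
      by (intro mult_right_mono powr_le_dyadic R k Kb0)
    finally have "norm_RN N z powr q * K z \<le> c k"
      by (simp add: c_def mult_ac)
    then have "ennreal (indicator S z * (norm_RN N z powr q * K z))
        \<le> ennreal (c k) * indicator (A k) z"
      using True k z by (simp add: A_def ball_RN_def ennreal_leI)
    also have "\<dots> = sum (\<lambda>k. ennreal (c k) * indicator (A k) z) {k}"
      by (simp del: sum_mult_indicator)
    also have "\<dots> \<le> (\<Sum>k. ennreal (c k) * indicator (A k) z)"
      by (rule sum_le_suminf) auto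
    finally show ?thesis .
  next
    case False
    \<comment> \<open>No shell contains the origin; the integrand vanishes there because
      \<open>0 powr q\<close> is 0 for every q, negative or not.\<close>
    then have "ennreal (indicator S z * (norm_RN N z powr q * K z)) = 0"
      by (cases "z = 0") auto
    then show ?thesis
      by simp
  qed
  have "(\<integral>\<^sup>+z. ennreal (indicator S z * (norm_RN N z powr q * K z)) \<partial>lebesgue_RN N)
      \<le> (\<integral>\<^sup>+z. (\<Sum>k. ennreal (c k) * indicator (A k) z) \<partial>lebesgue_RN N)"
    by (intro nn_integral_mono pt)
  also have "\<dots> = (\<Sum>k. ennreal (c k) * emeasure (lebesgue_RN N) (A k))"
    by (subst nn_integral_suminf) (auto simp: A_def nn_integral_cmult_indicator)
  also have "\<dots> \<le> (\<Sum>k. ennreal (Kb * 2 powr \<bar>s\<bar> * 2 ^ N * R k powr (q - \<sigma>)))"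
  proof (intro suminf_le summableI)
    fix k
    have "ennreal (c k) * emeasure (lebesgue_RN N) (A k) \<le> ennreal (c k) * ennreal ((2 * R k) ^ N)"
      unfolding A_def by (intro mult_left_mono emeasure_ball_RN_le) (use R[of k] in simp_all)
    also have "\<dots> = ennreal (c k * (2 * R k) ^ N)"
      using c0[of k] R[of k] by (simp add: ennreal_mult)
    also have "c k * (2 * R k) ^ N = Kb * 2 powr \<bar>s\<bar> * 2 ^ N * R k powr (q - \<sigma>)"
    proof -
      have "R k powr (q - \<sigma>) = R k powr s * R k ^ N"
        using R[of k] by (simp add: s_def powr_realpow[symmetric] powr_add[symmetric])
      then show ?thesis
        by (simp add: c_def power_mult_distrib mult_ac)
    qed
    finally show "ennreal (c k) * emeasure (lebesgue_RN N) (A k)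
        \<le> ennreal (Kb * 2 powr \<bar>s\<bar> * 2 ^ N * R k powr (q - \<sigma>))" .
  qed
  finally show ?thesis
    by (simp add: s_def)
qed

lemma admissible_kernel_bound:
  assumes "admissible_kernel N \<sigma> K"
  obtains Kb where "\<And>z. z \<in> RN N \<Longrightarrow> K z * norm_RN N z powr (real N + \<sigma>) \<le> Kb"
proof -
  from assms have "bounded ((\<lambda>z. K z * norm_RN N z powr (real N + \<sigma>)) ` RN N)"
    by (simp add: admissible_kernel_def)
  then obtain B where "\<forall>z\<in>RN N. \<bar>K z * norm_RN N z powr (real N + \<sigma>)\<bar> \<le> B"
    by (auto simp: bounded_iff)
  then show ?thesis
    using that[of B] by (meson abs_le_D1)
qed

lemma admissible_kernel_nonneg: "admissible_kernel N \<sigma> K \<Longrightarrow> z \<in> RN N \<Longrightarrow> 0 \<le> K z"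
  by (simp add: admissible_kernel_def)

lemma suminf_ennreal_geometric:
  fixes C \<rho> :: real
  assumes "0 \<le> C" "0 \<le> \<rho>" "\<rho> < 1"
  shows "(\<Sum>k. ennreal (C * \<rho> ^ k)) = ennreal (C / (1 - \<rho>))"
proof (rule suminf_ennreal_eq)
  show "(\<lambda>k. C * \<rho> ^ k) sums (C / (1 - \<rho>))"
    using sums_mult[OF geometric_sums[of \<rho>], of C] assms by simp
qed (use assms in simp)

text \<open>With radii \<delta> / 2^k the dyadic series is geometric of ratio 2^(\<sigma> - q), and
  q > \<sigma> is exactly what makes it converge.\<close>

lemma kernel_moment_near:
  assumes K: "admissible_kernel N \<sigma> K" and q: "\<sigma> < q"
  obtains C where "0 \<le> C" and "\<And>\<delta>. 0 < \<delta> \<Longrightarrow>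
    (\<integral>\<^sup>+z. ennreal (indicator (ball_RN N 0 \<delta>) z * (norm_RN N z powr q * K z)) \<partial>lebesgue_RN N)
      \<le> ennreal (C * \<delta> powr (q - \<sigma>))"
proof -
  obtain Kb where Kb: "\<And>z. z \<in> RN N \<Longrightarrow> K z * norm_RN N z powr (real N + \<sigma>) \<le> Kb"
    using admissible_kernel_bound[OF K] by blast
  have Kb0: "0 \<le> Kb"
    using Kb[OF zero_in_RN] by simp
  define c where "c = Kb * 2 powr \<bar>q - real N - \<sigma>\<bar> * 2 ^ N"
  define \<rho> :: real where "\<rho> = 2 powr (\<sigma> - q)"
  have c: "0 \<le> c"
    using Kb0 by (simp add: c_def)
  have \<rho>: "0 < \<rho>" "\<rho> < 1"
    using q by (simp_all add: \<rho>_def powr_less_one)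
  show thesis
  proof (rule that[of "c / (1 - \<rho>)"])
    show "0 \<le> c / (1 - \<rho>)"
      using c \<rho> by simp
    fix \<delta> :: real assume \<delta>: "0 < \<delta>"
    define R where "R k = \<delta> * (1/2) ^ k" for k :: nat
    have "(\<integral>\<^sup>+z. ennreal (indicator (ball_RN N 0 \<delta>) z * (norm_RN N z powr q * K z)) \<partial>lebesgue_RN N)
        \<le> (\<Sum>k. ennreal (c * R k powr (q - \<sigma>)))"
      unfolding c_def
    proof (rule kernel_nn_integral_dyadic[OF admissible_kernel_nonneg[OF K] Kb])
      fix z assume z: "z \<in> ball_RN N 0 \<delta>" "z \<noteq> 0"
      let ?r = "norm_RN N z"
      have pos: "0 < ?r"
        using z norm_RN_eq_0_iff[of z N] norm_RN_nonneg[of N z]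
        by (auto simp: ball_RN_def less_le simp del: norm_RN_nonneg)
      have ex: "\<exists>k. R k \<le> ?r"
      proof -
        obtain k where "(1/2) ^ k < ?r / \<delta>"
          using real_arch_pow_inv[of "?r / \<delta>" "1/2"] pos \<delta> by auto
        then show ?thesis
          using \<delta> by (intro exI[of _ k]) (simp add: R_def field_simps)
      qed
      \<comment> \<open>The least k with R k \<le> |z| is positive, since |z| < \<delta> = R 0. The
        shell containing z is that of its predecessor j, whose inner radius R j / 2 equals R
        k.\<close>
      define k where "k = (LEAST k. R k \<le> ?r)"
      have k: "R k \<le> ?r"
        unfolding k_def using ex by (rule LeastI_ex)
      have "k \<noteq> 0"
        using k z by (auto simp: R_def ball_RN_def)
      then obtain j where j: "k = Suc j"
        by (cases k) auto
      have "\<not> R j \<le> ?r"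
        using not_less_Least[of j "\<lambda>k. R k \<le> ?r"] j by (simp add: k_def)
      then show "\<exists>k. R k / 2 \<le> ?r \<and> ?r < R k"
        using k j by (intro exI[of _ j]) (simp add: R_def)
    qed (use \<delta> in \<open>auto simp: R_def ball_RN_def\<close>)
    also have "(\<lambda>k. c * R k powr (q - \<sigma>)) = (\<lambda>k. (c * \<delta> powr (q - \<sigma>)) * \<rho> ^ k)"
    proof
      fix k
      have "R k powr (q - \<sigma>) = \<delta> powr (q - \<sigma>) * ((1/2) ^ k) powr (q - \<sigma>)"
        using \<delta> by (simp add: R_def powr_mult)
      also have "((1/2::real) ^ k) powr (q - \<sigma>) = \<rho> ^ k"
        by (simp add: \<rho>_def powr_realpow[symmetric] powr_powr powr_divide powr_minus[symmetric]
            powr_one_eq_one algebra_simps)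
           (simp add: powr_minus[symmetric] divide_inverse algebra_simps)
      finally show "c * R k powr (q - \<sigma>) = (c * \<delta> powr (q - \<sigma>)) * \<rho> ^ k"
        by simp
    qed
    also have "(\<Sum>k. ennreal ((c * \<delta> powr (q - \<sigma>)) * \<rho> ^ k))
        = ennreal (c / (1 - \<rho>) * \<delta> powr (q - \<sigma>))"
      using c \<rho> by (subst suminf_ennreal_geometric) auto
    finally show "(\<integral>\<^sup>+z. ennreal (indicator (ball_RN N 0 \<delta>) z * (norm_RN N z powr q * K z))
        \<partial>lebesgue_RN N) \<le> ennreal (c / (1 - \<rho>) * \<delta> powr (q - \<sigma>))" .
  qed
qed

text \<open>The mirror image with doubling radii, where convergence requires q < \<sigma>. The case
  q = 0 gives the mass of the kernel outside a ball; q slightly below \<sigma> gives a bound that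
  grows slowly as \<delta> tends to 0.\<close>

lemma kernel_moment_far:
  assumes K: "admissible_kernel N \<sigma> K" and q: "q < \<sigma>"
  obtains C where "0 \<le> C" and "\<And>\<delta>. 0 < \<delta> \<Longrightarrow>
    (\<integral>\<^sup>+z. ennreal (indicator (RN N - ball_RN N 0 \<delta>) z * (norm_RN N z powr q * K z))
        \<partial>lebesgue_RN N)
      \<le> ennreal (C * \<delta> powr (q - \<sigma>))"
proof -
  obtain Kb where Kb: "\<And>z. z \<in> RN N \<Longrightarrow> K z * norm_RN N z powr (real N + \<sigma>) \<le> Kb"
    using admissible_kernel_bound[OF K] by blast
  have Kb0: "0 \<le> Kb"
    using Kb[OF zero_in_RN] by simp
  define c where "c = Kb * 2 powr \<bar>q - real N - \<sigma>\<bar> * 2 ^ N"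
  define \<rho> :: real where "\<rho> = 2 powr (q - \<sigma>)"
  have c: "0 \<le> c"
    using Kb0 by (simp add: c_def)
  have \<rho>: "0 < \<rho>" "\<rho> < 1"
    using q by (simp_all add: \<rho>_def powr_less_one)
  show thesis
  proof (rule that[of "c * \<rho> / (1 - \<rho>)"])
    show "0 \<le> c * \<rho> / (1 - \<rho>)"
      using c \<rho> by simp
    fix \<delta> :: real assume \<delta>: "0 < \<delta>"
    \<comment> \<open>The exponent starts at 1 so that the inner radius R 0 / 2 of the first shell
      is \<delta>.\<close>
    define R where "R k = \<delta> * 2 ^ Suc k" for k :: nat
    have "(\<integral>\<^sup>+z. ennreal (indicator (RN N - ball_RN N 0 \<delta>) z * (norm_RN N z powr q * K z))
          \<partial>lebesgue_RN N)
        \<le> (\<Sum>k. ennreal (c * R k powr (q - \<sigma>)))"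
      unfolding c_def
    proof (rule kernel_nn_integral_dyadic[OF admissible_kernel_nonneg[OF K] Kb])
      fix z assume z: "z \<in> RN N - ball_RN N 0 \<delta>" "z \<noteq> 0"
      let ?r = "norm_RN N z"
      have ge: "\<delta> \<le> ?r"
        using z by (auto simp: ball_RN_def)
      have ex: "\<exists>k. ?r < R k"
      proof -
        obtain k where "?r / \<delta> < 2 ^ k"
          using real_arch_pow[of 2 "?r / \<delta>"] by auto
        also have "(2::real) ^ k \<le> 2 ^ Suc k"
          by simp
        finally show ?thesis
          using \<delta> by (intro exI[of _ k]) (simp add: R_def field_simps)
      qed
      define k where "k = (LEAST k. ?r < R k)"
      have k: "?r < R k"
        unfolding k_def using ex by (rule LeastI_ex)
      have "R k / 2 \<le> ?r"
      proof (cases k)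
        case 0
        then show ?thesis
          using ge by (simp add: R_def)
      next
        case (Suc j)
        then have "\<not> ?r < R j"
          using not_less_Least[of j "\<lambda>k. ?r < R k"] by (simp add: k_def)
        then show ?thesis
          using Suc by (simp add: R_def)
      qed
      then show "\<exists>k. R k / 2 \<le> ?r \<and> ?r < R k"
        using k by blast
    qed (use \<delta> in \<open>auto simp: R_def\<close>)
    also have "(\<lambda>k. c * R k powr (q - \<sigma>)) = (\<lambda>k. (c * \<rho> * \<delta> powr (q - \<sigma>)) * \<rho> ^ k)"
    proof
      fix k
      have "R k powr (q - \<sigma>) = \<delta> powr (q - \<sigma>) * (2 ^ Suc k) powr (q - \<sigma>)"
        unfolding R_def by (rule powr_mult)
      also have "((2::real) ^ Suc k) powr (q - \<sigma>) = \<rho> ^ Suc k"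
        unfolding \<rho>_def by (simp add: powr_realpow[symmetric] powr_powr mult.commute del: power_Suc)
      finally show "c * R k powr (q - \<sigma>) = (c * \<rho> * \<delta> powr (q - \<sigma>)) * \<rho> ^ k"
        by simp
    qed
    also have "(\<Sum>k. ennreal ((c * \<rho> * \<delta> powr (q - \<sigma>)) * \<rho> ^ k))
        = ennreal (c * \<rho> / (1 - \<rho>) * \<delta> powr (q - \<sigma>))"
      using c \<rho> by (subst suminf_ennreal_geometric) auto
    finally show "(\<integral>\<^sup>+z. ennreal (indicator (RN N - ball_RN N 0 \<delta>) z * (norm_RN N z powr q * K z))
        \<partial>lebesgue_RN N) \<le> ennreal (c * \<rho> / (1 - \<rho>) * \<delta> powr (q - \<sigma>))" .
  qed
qed

section \<open>Separable test functions\<close>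

text \<open>All test functions of the proof are sums of functions of one coordinate each, which
  reduces regularity on the space of sequences to one-variable calculus.\<close>

lemma C1_QT_separable:
  assumes h: "\<And>i s. i < N \<Longrightarrow> (h i has_real_derivative h' i s) (at s)"
    and h': "\<And>i. i < N \<Longrightarrow> continuous_on UNIV (h' i)"
    and k: "\<And>s. (k has_real_derivative k' s) (at s)"
    and k': "continuous_on UNIV k'"
  shows "C1_QT N T (\<lambda>(x, t). (\<Sum>i<N. h i (x i)) + k t)
    (\<lambda>(x, t) i. if i < N then h' i (x i) else 0) (\<lambda>(x, t). k' t)"
proof -
  have proj: "continuous_on S (\<lambda>q::point. fst q i)" for S i
    using continuous_on_compose2[of UNIV "\<lambda>x. x i" S fst] continuous_on_coordinate
    by (simp add: continuous_on_fst)
  have hc: "continuous_on UNIV (h i)" if "i < N" for i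
    using h[OF that] by (meson DERIV_continuous_on has_field_derivative_at_within)
  have kc: "continuous_on UNIV k"
    using k by (meson DERIV_continuous_on has_field_derivative_at_within)
  show ?thesis
    unfolding C1_QT_def
  proof (intro conjI)
    show "continuous_on (QT N T) (\<lambda>(x, t). (\<Sum>i<N. h i (x i)) + k t)"
      unfolding case_prod_beta
      by (intro continuous_intros continuous_on_compose2[OF hc proj]
          continuous_on_compose2[OF kc]) auto
    show "continuous_on (QT N T) (\<lambda>(x, t) i. if i < N then h' i (x i) else 0)"
      unfolding case_prod_beta
    proof (rule continuous_on_coordinatewise_then_product)
      fix i
      show "continuous_on (QT N T) (\<lambda>q. if i < N then h' i (fst q i) else 0)"
        by (cases "i < N") (auto intro!: continuous_on_compose2[OF h' proj])
    qed
    show "continuous_on (QT N T) (\<lambda>(x, t). k' t)"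
      unfolding case_prod_beta
      by (intro continuous_on_compose2[OF k'] continuous_intros) auto
    have space: "((\<lambda>s. (\<Sum>j<N. h j ((x(i := s)) j)) + k t) has_real_derivative h' i (x i))
        (at (x i))" if i: "i < N" for i x t
    proof -
      have "((\<lambda>s. (\<Sum>j<N. h j ((x(i := s)) j)) + k t) has_real_derivative
          (\<Sum>j<N. if j = i then h' i (x i) else 0) + 0) (at (x i))"
      proof (intro DERIV_add DERIV_sum DERIV_const)
        fix j assume "j \<in> {..<N}"
        then show "((\<lambda>s. h j ((x(i := s)) j)) has_real_derivative
            (if j = i then h' i (x i) else 0)) (at (x i))"
          using h[OF i] by (cases "j = i") auto
      qed
      then show ?thesis
        using i by simp
    qed
    have time: "((\<lambda>s. (\<Sum>j<N. h j (x j)) + k s) has_real_derivative k' t) (at t within {0<..T})"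
      for x :: vec and t
      using DERIV_add[OF DERIV_const has_field_derivative_at_within[OF k]] by simp
    show "\<forall>(x, t)\<in>QT N T.
      (case (x, t) of (x, t) \<Rightarrow> \<lambda>i. if i < N then h' i (x i) else 0) \<in> RN N \<and>
      (\<forall>i<N. ((\<lambda>s. case (x(i := s), t) of (x, t) \<Rightarrow> (\<Sum>i<N. h i (x i)) + k t)
          has_real_derivative (case (x, t) of (x, t) \<Rightarrow> \<lambda>i. if i < N then h' i (x i) else 0) i)
          (at (x i))) \<and>
      ((\<lambda>s. case (x, s) of (x, t) \<Rightarrow> (\<Sum>i<N. h i (x i)) + k t)
          has_real_derivative (case (x, t) of (x, t) \<Rightarrow> k' t)) (at t within {0<..T})"
      using space time by (auto simp: RN_def)
  qed
qed

lemma C2_QT_separable: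
  assumes h: "\<And>i s. i < N \<Longrightarrow> (h i has_real_derivative h' i s) (at s)"
    and h': "\<And>i s. i < N \<Longrightarrow> (h' i has_real_derivative h'' i s) (at s)"
    and h'': "\<And>i. i < N \<Longrightarrow> continuous_on UNIV (h'' i)"
    and k: "\<And>s. (k has_real_derivative k' s) (at s)"
    and k': "\<And>s. (k' has_real_derivative k'' s) (at s)"
    and k'': "continuous_on UNIV k''"
  shows "C2_QT N T (\<lambda>(x, t). (\<Sum>i<N. h i (x i)) + k t)
    (\<lambda>(x, t) i. if i < N then h' i (x i) else 0) (\<lambda>(x, t). k' t)"
proof -
  have h'c: "continuous_on UNIV (h' i)" if "i < N" for i
    using h'[OF that] by (meson DERIV_continuous_on has_field_derivative_at_within)
  have k'c: "continuous_on UNIV k'"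
    using k' by (meson DERIV_continuous_on has_field_derivative_at_within)
  have space: "\<exists>g gt. C1_QT N T (\<lambda>q. (case q of (x, t) \<Rightarrow> \<lambda>i. if i < N then h' i (x i) else 0) i) g gt"
    if i: "i < N" for i
  proof -
    \<comment> \<open>A component of the gradient depends on a single coordinate, so it is again
      separable, with all other summands zero, and the first-order lemma applies to it.\<close>
    have *: "(\<lambda>q::point. (case q of (x, t) \<Rightarrow> \<lambda>i. if i < N then h' i (x i) else 0) i)
      = (\<lambda>(x, t). (\<Sum>j<N. (if j = i then h' i else (\<lambda>_. 0)) (x j)) + (\<lambda>_. 0) t)"
      using i by (auto simp: fun_eq_iff if_distrib[of "\<lambda>f. f _"] sum.delta' cong: if_cong)
    show ?thesis
      unfolding *
    proof (intro exI, rule C1_QT_separable)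
      fix j s
      show "((if j = i then h' i else (\<lambda>_. 0)) has_real_derivative
          (if j = i then h'' i else (\<lambda>_. 0)) s) (at s)"
        using h'[OF i] by simp
      show "continuous_on UNIV (if j = i then h'' i else (\<lambda>_. 0))"
        using h''[OF i] by simp
    qed (rule DERIV_const continuous_on_const)+
  qed
  have time: "\<exists>g gt. C1_QT N T (\<lambda>(x, t). k' t) g gt"
  proof -
    have *: "(\<lambda>(x::vec, t). k' t) = (\<lambda>(x, t). (\<Sum>j<N. (\<lambda>_ _. 0) j (x j)) + k' t)"
      by simp
    show ?thesis
      unfolding *
      by (intro exI, rule C1_QT_separable) (rule DERIV_const continuous_on_const k' k'')+
  qed
  show ?thesis
    unfolding C2_QT_def using space time
    by (auto intro!: C1_QT_separable h h'c k k'c)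
qed

text \<open>The mean value theorem is applied twice, to h and to h'. This loses the factor 1/2 of
  Taylor's formula, but constants do not matter here.\<close>

lemma taylor_second_order_bound:
  fixes h :: "real \<Rightarrow> real"
  assumes h: "\<And>s. (h has_real_derivative h' s) (at s)"
    and h': "\<And>s. (h' has_real_derivative h'' s) (at s)"
    and B: "\<And>s. \<bar>h'' s\<bar> \<le> B"
  shows "\<bar>h (s + w) - h s - h' s * w\<bar> \<le> B * w\<^sup>2"
proof -
  have mvt: "\<exists>\<xi>. \<bar>\<xi> - s\<bar> \<le> \<bar>w\<bar> \<and> f (s + w) - f s = f' \<xi> * w"
    if f: "\<And>s. (f has_real_derivative f' s) (at s)" for f f' :: "real \<Rightarrow> real" and w
  proof (cases w "0 :: real" rule: linorder_cases)
    case less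
    then obtain \<xi> where "s + w < \<xi>" "\<xi> < s" "f s - f (s + w) = (s - (s + w)) * f' \<xi>"
      using MVT2[of "s + w" s f f'] f by auto
    then show ?thesis
      by (intro exI[of _ \<xi>]) (auto simp: algebra_simps)
  next
    case greater
    then obtain \<xi> where "s < \<xi>" "\<xi> < s + w" "f (s + w) - f s = (s + w - s) * f' \<xi>"
      using MVT2[of s "s + w" f f'] f by auto
    then show ?thesis
      by (intro exI[of _ \<xi>]) (auto simp: algebra_simps)
  qed auto
  obtain \<xi> where \<xi>: "\<bar>\<xi> - s\<bar> \<le> \<bar>w\<bar>" "h (s + w) - h s = h' \<xi> * w"
    using mvt[OF h, of w] by blast
  obtain \<zeta> where \<zeta>: "h' \<xi> - h' s = h'' \<zeta> * (\<xi> - s)"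
    using mvt[OF h', of "\<xi> - s"] by auto
  have "h (s + w) - h s - h' s * w = (h' \<xi> - h' s) * w"
    using \<xi> by (simp add: algebra_simps)
  then have "\<bar>h (s + w) - h s - h' s * w\<bar> = \<bar>h'' \<zeta>\<bar> * \<bar>\<xi> - s\<bar> * \<bar>w\<bar>"
    by (simp add: \<zeta> abs_mult)
  also have "\<dots> \<le> B * \<bar>w\<bar> * \<bar>w\<bar>"
    using B[of \<zeta>] \<xi>(1) by (intro mult_right_mono mult_mono) auto
  finally show ?thesis
    by (simp add: power2_eq_square)
qed

section \<open>Bumps and the spatial penalty\<close>

text \<open>A bounded substitute for s^2: it vanishes only at 0, is at least 1/2 once |s| \<ge> 1,
  and has bounded first and second derivatives on the whole line. Multiplied by \<beta> it perturbs
  values and derivatives uniformly by O(\<beta>).\<close>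

definition bump1 :: "real \<Rightarrow> real" where
  "bump1 s = s\<^sup>2 / (1 + s\<^sup>2)"

definition bump1' :: "real \<Rightarrow> real" where
  "bump1' s = 2 * s / (1 + s\<^sup>2)\<^sup>2"

definition bump1'' :: "real \<Rightarrow> real" where
  "bump1'' s = (2 - 6 * s\<^sup>2) / (1 + s\<^sup>2) ^ 3"

lemma one_plus_square_pos: "0 < 1 + s\<^sup>2" for s :: real
  using zero_le_power2[of s] by linarith

lemma bump1_bounds: "0 \<le> bump1 s" "bump1 s \<le> 1"
  by (simp_all add: bump1_def one_plus_square_pos)

lemma bump1_ge_half: "1 \<le> \<bar>s\<bar> \<Longrightarrow> 1 / 2 \<le> bump1 s"
proof -
  assume "1 \<le> \<bar>s\<bar>"
  then have "1 \<le> s\<^sup>2"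
    by (metis abs_le_square_iff abs_one one_power2)
  then show ?thesis
    by (simp add: bump1_def one_plus_square_pos field_simps)
qed

lemma DERIV_bump1: "(bump1 has_real_derivative bump1' s) (at s)"
  unfolding bump1_def[abs_def] bump1'_def using one_plus_square_pos[of s]
  by (auto intro!: derivative_eq_intros simp: field_simps power2_eq_square)

lemma DERIV_bump1': "(bump1' has_real_derivative bump1'' s) (at s)"
  unfolding bump1'_def[abs_def] bump1''_def using one_plus_square_pos[of s]
  by (auto intro!: derivative_eq_intros simp: divide_simps)
    (simp add: algebra_simps eval_nat_numeral)

lemma continuous_on_bump1'': "continuous_on S bump1''"
  unfolding bump1''_def[abs_def] using one_plus_square_pos
  by (intro continuous_intros) (metis less_irrefl power_not_zero)

lemma abs_bump1'_le: "\<bar>bump1' s\<bar> \<le> 1"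
proof -
  have "2 * \<bar>s\<bar> \<le> 1 + s\<^sup>2"
    using zero_le_power2[of "\<bar>s\<bar> - 1"] by (simp add: power2_diff)
  also have "\<dots> \<le> (1 + s\<^sup>2)\<^sup>2"
    by (rule self_le_power) simp_all
  finally show ?thesis
    using one_plus_square_pos[of s] by (simp add: bump1'_def abs_mult)
qed

lemma abs_bump1''_le: "\<bar>bump1'' s\<bar> \<le> 2"
proof -
  have "(1 + s\<^sup>2) ^ 3 = 1 + 3 * s\<^sup>2 + 3 * (s\<^sup>2)\<^sup>2 + (s\<^sup>2) ^ 3"
    by (simp add: algebra_simps eval_nat_numeral)
  moreover have "0 \<le> (s\<^sup>2) ^ 3" "0 \<le> (s\<^sup>2)\<^sup>2" "0 \<le> s\<^sup>2"
    by (intro zero_le_power zero_le_power2)+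
  \<comment> \<open>The term 2 * 3 s^2 in the expansion of the right-hand side absorbs 6
    s^2.\<close>
  ultimately have "\<bar>2 - 6 * s\<^sup>2\<bar> \<le> 2 * (1 + s\<^sup>2) ^ 3"
    by linarith
  then show ?thesis
    using one_plus_square_pos[of s] by (simp add: bump1''_def divide_le_eq)
qed

text \<open>Summing over coordinates, rather than using the norm, keeps the bump separable and
  matches the unit boxes on which the maximum is sought.\<close>

definition bump :: "nat \<Rightarrow> vec \<Rightarrow> vec \<Rightarrow> real" where
  "bump N a x = (\<Sum>i<N. bump1 (x i - a i))"

lemma bump_bounds: "0 \<le> bump N a x" "bump N a x \<le> real N"
proof -
  show "0 \<le> bump N a x"
    by (simp add: bump_def sum_nonneg bump1_bounds)
  show "bump N a x \<le> real N"
    using sum_bounded_above[of "{..<N}" "\<lambda>i. bump1 (x i - a i)" 1]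
    by (simp add: bump_def bump1_bounds)
qed

lemma bump_center [simp]: "bump N a a = 0"
  by (simp add: bump_def bump1_def)

lemma bump_ge_half:
  assumes "i < N" "1 \<le> \<bar>x i - a i\<bar>"
  shows "1 / 2 \<le> bump N a x"
proof -
  have "1 / 2 \<le> bump1 (x i - a i)"
    by (rule bump1_ge_half) fact
  also have "\<dots> \<le> bump N a x"
    unfolding bump_def by (rule member_le_sum) (use assms bump1_bounds in auto)
  finally show ?thesis .
qed

text \<open>The part of the doubled functional that depends on one space point when the other one is
  frozen at c; a is the centre of the bump.\<close>

definition penalty :: "nat \<Rightarrow> real \<Rightarrow> real \<Rightarrow> vec \<Rightarrow> vec \<Rightarrow> vec \<Rightarrow> real" where
  "penalty N \<epsilon> \<beta> c a x = (norm_RN N (x - c))\<^sup>2 / \<epsilon> + \<beta> * bump N a x"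

definition penalty_grad :: "nat \<Rightarrow> real \<Rightarrow> real \<Rightarrow> vec \<Rightarrow> vec \<Rightarrow> vec \<Rightarrow> vec" where
  "penalty_grad N \<epsilon> \<beta> c a x =
     (\<lambda>i. if i < N then 2 * (x i - c i) / \<epsilon> + \<beta> * bump1' (x i - a i) else 0)"

lemma penalty_grad_in_RN: "penalty_grad N \<epsilon> \<beta> c a x \<in> RN N"
  by (simp add: penalty_grad_def RN_def)

lemma penalty_eq_sum:
  "penalty N \<epsilon> \<beta> c a x = (\<Sum>i<N. (x i - c i)\<^sup>2 / \<epsilon> + \<beta> * bump1 (x i - a i))"
  by (simp add: penalty_def norm_RN_power2 bump_def sum.distrib sum_divide_distrib sum_distrib_left)

lemma DERIV_penalty_summand:
  "((\<lambda>s. (s - c)\<^sup>2 / \<epsilon> + \<beta> * bump1 (s - a)) has_real_derivative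
     2 * (s - c) / \<epsilon> + \<beta> * bump1' (s - a)) (at s)"
  unfolding divide_inverse
  by (auto intro!: derivative_eq_intros DERIV_chain2[OF DERIV_bump1])

lemma DERIV_penalty_summand':
  "((\<lambda>s. 2 * (s - c) / \<epsilon> + \<beta> * bump1' (s - a)) has_real_derivative
     2 / \<epsilon> + \<beta> * bump1'' (s - a)) (at s)"
  unfolding divide_inverse
  by (auto intro!: derivative_eq_intros DERIV_chain2[OF DERIV_bump1'])

text \<open>The free parameters let one statement serve both tests: \<tau> = 1, \<kappa> =
  1/\<epsilon> and slope \<eta> for the subsolution, \<tau> = -1, \<kappa> = -1/\<epsilon> and slope
  0 for the supersolution.\<close>

lemma C2_QT_penalty:
  fixes \<tau> \<kappa> \<eta> s :: real
  shows "C2_QT N T (\<lambda>(x, t). \<tau> * penalty N \<epsilon> \<beta> c a x + (\<kappa> * (t - s)\<^sup>2 + \<eta> * t))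
    (\<lambda>(x, t) i. \<tau> * penalty_grad N \<epsilon> \<beta> c a x i) (\<lambda>(x, t). 2 * \<kappa> * (t - s) + \<eta>)"
proof -
  have k: "((\<lambda>t. \<kappa> * (t - s)\<^sup>2 + \<eta> * t) has_real_derivative 2 * \<kappa> * (r - s) + \<eta>) (at r)"
    and k': "((\<lambda>t. 2 * \<kappa> * (t - s) + \<eta>) has_real_derivative 2 * \<kappa>) (at r)" for r
    by (auto intro!: derivative_eq_intros)
  have "C2_QT N T
    (\<lambda>(x, t). (\<Sum>i<N. \<tau> * ((x i - c i)\<^sup>2 / \<epsilon> + \<beta> * bump1 (x i - a i))) + (\<kappa> * (t - s)\<^sup>2 + \<eta> * t))
    (\<lambda>(x, t) i. if i < N then \<tau> * (2 * (x i - c i) / \<epsilon> + \<beta> * bump1' (x i - a i)) else 0)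
    (\<lambda>(x, t). 2 * \<kappa> * (t - s) + \<eta>)"
  proof (rule C2_QT_separable[where h'' = "\<lambda>i s. \<tau> * (2 / \<epsilon> + \<beta> * bump1'' (s - a i))"
        and k'' = "\<lambda>_. 2 * \<kappa>"])
    show "continuous_on UNIV (\<lambda>s. \<tau> * (2 / \<epsilon> + \<beta> * bump1'' (s - a i)))" for i
      by (intro continuous_on_mult continuous_on_add continuous_on_const
          continuous_on_compose2[OF continuous_on_bump1''[of UNIV]] continuous_on_diff
          continuous_on_id) auto
  qed (rule DERIV_cmult DERIV_penalty_summand DERIV_penalty_summand' k k' continuous_on_const)+
  moreover have "(\<lambda>(x, t). \<tau> * penalty N \<epsilon> \<beta> c a x + (\<kappa> * (t - s)\<^sup>2 + \<eta> * t))
     = (\<lambda>(x, t). (\<Sum>i<N. \<tau> * ((x i - c i)\<^sup>2 / \<epsilon> + \<beta> * bump1 (x i - a i))) + (\<kappa> * (t - s)\<^sup>2 + \<eta> * t))"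
    by (simp add: penalty_eq_sum sum_distrib_left)
  moreover have "(\<lambda>(x::vec, t::real) i. \<tau> * penalty_grad N \<epsilon> \<beta> c a x i)
     = (\<lambda>(x, t) i. if i < N then \<tau> * (2 * (x i - c i) / \<epsilon> + \<beta> * bump1' (x i - a i)) else 0)"
    by (auto simp: penalty_grad_def fun_eq_iff)
  ultimately show ?thesis
    by simp
qed

text \<open>Of the constant 4/\<epsilon>, the quadratic contributes 2/\<epsilon> and the bump at
  most 2 \<beta> \<le> 2/\<epsilon>, as \<beta> and \<epsilon> are at most 1.\<close>

lemma penalty_taylor:
  assumes "0 < \<epsilon>" "\<epsilon> \<le> 1" "0 \<le> \<beta>" "\<beta> \<le> 1"
  shows "\<bar>penalty N \<epsilon> \<beta> c a (x + z) - penalty N \<epsilon> \<beta> c a x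
      - inner_RN N (penalty_grad N \<epsilon> \<beta> c a x) z\<bar> \<le> 4 / \<epsilon> * (norm_RN N z)\<^sup>2"
proof -
  define h where "h i s = (s - c i)\<^sup>2 / \<epsilon> + \<beta> * bump1 (s - a i)" for i s
  define h' where "h' i s = 2 * (s - c i) / \<epsilon> + \<beta> * bump1' (s - a i)" for i s
  have le: "\<bar>h i (x i + z i) - h i (x i) - h' i (x i) * z i\<bar> \<le> 4 / \<epsilon> * (z i)\<^sup>2" for i
  proof (rule taylor_second_order_bound[where h'' = "\<lambda>s. 2 / \<epsilon> + \<beta> * bump1'' (s - a i)"])
    fix s
    show "(h i has_real_derivative h' i s) (at s)"
      unfolding h_def[abs_def] h'_def by (rule DERIV_penalty_summand)
    show "(h' i has_real_derivative 2 / \<epsilon> + \<beta> * bump1'' (s - a i)) (at s)"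
      unfolding h'_def[abs_def] by (rule DERIV_penalty_summand')
    have "\<bar>\<beta> * bump1'' (s - a i)\<bar> \<le> 1 * 2"
      unfolding abs_mult using assms abs_bump1''_le by (intro mult_mono) auto
    also have "\<dots> \<le> 2 / \<epsilon>"
      using assms by (simp add: field_simps)
    finally show "\<bar>2 / \<epsilon> + \<beta> * bump1'' (s - a i)\<bar> \<le> 4 / \<epsilon>"
      using assms by (simp add: abs_le_iff)
  qed
  have "penalty N \<epsilon> \<beta> c a (x + z) - penalty N \<epsilon> \<beta> c a x - inner_RN N (penalty_grad N \<epsilon> \<beta> c a x) z
      = (\<Sum>i<N. h i (x i + z i) - h i (x i) - h' i (x i) * z i)"
    unfolding penalty_eq_sum inner_RN_def h_def h'_def sum_subtractf[symmetric]
    by (intro sum.cong) (auto simp: penalty_grad_def)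
  also have "\<bar>\<dots>\<bar> \<le> (\<Sum>i<N. 4 / \<epsilon> * (z i)\<^sup>2)"
    by (rule order_trans[OF sum_abs sum_mono[OF le]])
  finally show ?thesis
    by (simp add: norm_RN_power2 sum_distrib_left)
qed

section \<open>Estimates of the nonlocal terms\<close>

text \<open>A function f that is not integrable has Bochner integral 0 by convention and satisfies
  the bound trivially. Pointwise domination by g is therefore all that has to be checked for f in an
  application.\<close>

lemma abs_set_integral_le_nn_integral:
  fixes f g :: "'a \<Rightarrow> real"
  assumes g: "(\<integral>\<^sup>+z. ennreal (indicator S z * g z) \<partial>M) \<le> ennreal B"
    and B: "0 \<le> B"
    and fg: "\<And>z. z \<in> S \<Longrightarrow> \<bar>f z\<bar> \<le> c * g z" and c: "0 \<le> c"
    and gm: "(\<lambda>z. indicator S z * g z) \<in> borel_measurable M"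
  shows "\<bar>LINT z:S|M. f z\<bar> \<le> c * B"
proof (cases "integrable M (\<lambda>z. indicator S z *\<^sub>R f z)")
  case True
  have "ennreal \<bar>LINT z:S|M. f z\<bar> \<le> (\<integral>\<^sup>+z. ennreal (norm (indicator S z *\<^sub>R f z)) \<partial>M)"
    unfolding set_lebesgue_integral_def real_norm_def[symmetric]
    by (rule integral_norm_bound_ennreal[OF True])
  also have "\<dots> \<le> (\<integral>\<^sup>+z. ennreal c * ennreal (indicator S z * g z) \<partial>M)"
    using fg c by (intro nn_integral_mono) (auto simp: ennreal_mult'[symmetric] indicator_def intro!: ennreal_leI)
  also have "\<dots> = ennreal c * (\<integral>\<^sup>+z. ennreal (indicator S z * g z) \<partial>M)"
    using gm by (intro nn_integral_cmult) auto
  also have "\<dots> \<le> ennreal c * ennreal B"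
    by (intro mult_left_mono g) simp
  also have "\<dots> = ennreal (c * B)"
    using c B by (simp add: ennreal_mult)
  finally show ?thesis
    using c B by (simp add: ennreal_le_iff)
next
  case False
  then show ?thesis
    using c B by (simp add: set_lebesgue_integral_def not_integrable_integral_eq)
qed

lemma admissible_kernel_measurable:
  "admissible_kernel N \<sigma> K \<Longrightarrow> K \<in> borel_measurable (lebesgue_RN N)"
  by (simp add: admissible_kernel_def)

text \<open>For \<sigma> = 1 the compensator leaves the second-order remainder A |z|^2. For \<sigma>
  < 1 the gradient term survives and, since |z| < 1, the integrand is at most (A + P) |z|. Both read
  (A + P) |z|^q with q = 1 + I > \<sigma>, so the near moment is finite.\<close>

lemma I_near_bound:
  assumes K: "admissible_kernel N \<sigma> K" and \<sigma>: "\<sigma> \<le> 1"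
  obtains C where "0 \<le> C" and
    "\<And>(\<delta>::real) A P \<phi> p x t. \<lbrakk>0 < \<delta>; \<delta> < 1; 0 \<le> A; norm_RN N p \<le> P;
      \<And>z. z \<in> RN N \<Longrightarrow> \<bar>\<phi> (x + z, t) - \<phi> (x, t) - inner_RN N p z\<bar> \<le> A * (norm_RN N z)\<^sup>2\<rbrakk>
      \<Longrightarrow> \<bar>I_near N \<sigma> K \<delta> \<phi> p x t\<bar> \<le> (A + P) * (C * \<delta> powr (1 + I_ind \<sigma> - \<sigma>))"
proof -
  define q where "q = 1 + I_ind \<sigma>"
  have "\<sigma> < q"
    using \<sigma> by (simp add: q_def I_ind_def)
  then obtain C where C: "0 \<le> C" "\<And>\<delta>::real. 0 < \<delta> \<Longrightarrow>
    (\<integral>\<^sup>+z. ennreal (indicator (ball_RN N 0 \<delta>) z * (norm_RN N z powr q * K z)) \<partial>lebesgue_RN N)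
      \<le> ennreal (C * \<delta> powr (q - \<sigma>))"
    using kernel_moment_near[OF K] by blast
  note [measurable] = admissible_kernel_measurable[OF K]
  show thesis
  proof (rule that[OF C(1)])
    fix \<delta> A P t :: real and \<phi> :: "point \<Rightarrow> real" and p x :: vec
    assume \<delta>: "0 < \<delta>" "\<delta> < 1" and A: "0 \<le> A" and P: "norm_RN N p \<le> P"
      and taylor: "\<And>z. z \<in> RN N \<Longrightarrow>
        \<bar>\<phi> (x + z, t) - \<phi> (x, t) - inner_RN N p z\<bar> \<le> A * (norm_RN N z)\<^sup>2"
    have P0: "0 \<le> P"
      using P norm_RN_nonneg order_trans by blast
    show "\<bar>I_near N \<sigma> K \<delta> \<phi> p x t\<bar> \<le> (A + P) * (C * \<delta> powr (1 + I_ind \<sigma> - \<sigma>))"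
      unfolding I_near_def q_def[symmetric]
    proof (rule abs_set_integral_le_nn_integral[OF C(2)[OF \<delta>(1)]])
      fix z assume "z \<in> ball_RN N 0 \<delta>"
      then have z: "z \<in> RN N" "norm_RN N z \<le> 1"
        using \<delta> by (auto simp: ball_RN_def)
      let ?r = "norm_RN N z"
      have Kz: "0 \<le> K z"
        using admissible_kernel_nonneg[OF K z(1)] .
      have "\<bar>\<phi> (x + z, t) - \<phi> (x, t) - I_ind \<sigma> * inner_RN N p z\<bar> \<le> (A + P) * ?r powr q"
      proof (cases "\<sigma> = 1")
        case True
        have "\<bar>\<phi> (x + z, t) - \<phi> (x, t) - I_ind \<sigma> * inner_RN N p z\<bar> \<le> A * ?r\<^sup>2"
          using taylor[OF z(1)] True by (simp add: I_ind_def)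
        also have "\<dots> \<le> (A + P) * ?r\<^sup>2"
          using P0 by (intro mult_right_mono) auto
        finally show ?thesis
          using True by (simp add: q_def I_ind_def)
      next
        case False
        have "\<bar>\<phi> (x + z, t) - \<phi> (x, t)\<bar> \<le> A * ?r\<^sup>2 + \<bar>inner_RN N p z\<bar>"
          using taylor[OF z(1)] by linarith
        also have "\<dots> \<le> A * ?r + P * ?r"
        proof (intro add_mono mult_left_mono)
          show "?r\<^sup>2 \<le> ?r"
            using z(2) by (simp add: power2_eq_square mult_left_le)
          show "\<bar>inner_RN N p z\<bar> \<le> P * ?r"
            by (rule order_trans[OF abs_inner_RN_le]) (intro mult_right_mono P norm_RN_nonneg)
        qed fact
        finally show ?thesis
          using False by (simp add: q_def I_ind_def distrib_right)
      qed
      then show "\<bar>(\<phi> (x + z, t) - \<phi> (x, t) - I_ind \<sigma> * inner_RN N p z) * K z\<bar>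
          \<le> (A + P) * (?r powr q * K z)"
        using Kz by (simp add: abs_mult mult.assoc[symmetric] mult_right_mono)
    qed (use C(1) A P0 in \<open>auto\<close>)
  qed
qed

text \<open>The compensator acts only where |z| < 1, and there P |z| \<le> P |z|^q because q < 1; so
  the same far moment controls it together with the increments of w.\<close>

lemma I_far_bound:
  assumes K: "admissible_kernel N \<sigma> K" and q: "0 \<le> q" "q < \<sigma>" and \<sigma>: "\<sigma> \<le> 1"
  obtains C where "0 \<le> C" and
    "\<And>(\<delta>::real) H P w p x t. \<lbrakk>0 < \<delta>; 0 \<le> H; norm_RN N p \<le> P;
      \<And>z. z \<in> RN N \<Longrightarrow> \<bar>w (x + z, t) - w (x, t)\<bar> \<le> H * norm_RN N z powr q\<rbrakk>
      \<Longrightarrow> \<bar>I_far N \<sigma> K \<delta> w p x t\<bar> \<le> (H + P) * (C * \<delta> powr (q - \<sigma>))"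
proof -
  obtain C where C: "0 \<le> C" "\<And>\<delta>::real. 0 < \<delta> \<Longrightarrow>
    (\<integral>\<^sup>+z. ennreal (indicator (RN N - ball_RN N 0 \<delta>) z * (norm_RN N z powr q * K z))
        \<partial>lebesgue_RN N)
      \<le> ennreal (C * \<delta> powr (q - \<sigma>))"
    using kernel_moment_far[OF K q(2)] by blast
  note [measurable] = admissible_kernel_measurable[OF K]
  show thesis
  proof (rule that[OF C(1)])
    fix \<delta> H P t :: real and w :: "point \<Rightarrow> real" and p x :: vec
    assume \<delta>: "0 < \<delta>" and H: "0 \<le> H" and P: "norm_RN N p \<le> P"
      and w: "\<And>z. z \<in> RN N \<Longrightarrow> \<bar>w (x + z, t) - w (x, t)\<bar> \<le> H * norm_RN N z powr q"
    have P0: "0 \<le> P"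
      using P norm_RN_nonneg order_trans by blast
    show "\<bar>I_far N \<sigma> K \<delta> w p x t\<bar> \<le> (H + P) * (C * \<delta> powr (q - \<sigma>))"
      unfolding I_far_def
    proof (rule abs_set_integral_le_nn_integral[OF C(2)[OF \<delta>]])
      fix z assume "z \<in> RN N - ball_RN N 0 \<delta>"
      then have z: "z \<in> RN N" "\<delta> \<le> norm_RN N z"
        by (auto simp: ball_RN_def)
      let ?r = "norm_RN N z"
      have Kz: "0 \<le> K z"
        using admissible_kernel_nonneg[OF K z(1)] .
      have "\<bar>I_ind \<sigma> * indicator (ball_RN N 0 1) z * inner_RN N p z\<bar> \<le> P * ?r powr q"
      proof (cases "z \<in> ball_RN N 0 1")
        case True
        have "\<bar>I_ind \<sigma> * indicator (ball_RN N 0 1) z * inner_RN N p z\<bar> \<le> 1 * \<bar>inner_RN N p z\<bar>"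
          using True by (simp add: I_ind_def)
        also have "\<dots> \<le> P * ?r"
          using order_trans[OF abs_inner_RN_le mult_right_mono[OF P norm_RN_nonneg]] by simp
        also have "?r = ?r powr 1"
          by simp
        also have "P * ?r powr 1 \<le> P * ?r powr q"
          using True z \<delta> q \<sigma> P0 by (intro mult_left_mono powr_mono') (auto simp: ball_RN_def)
        finally show ?thesis .
      qed (use P0 in simp)
      with w[OF z(1)]
      have "\<bar>w (x + z, t) - w (x, t) - I_ind \<sigma> * indicator (ball_RN N 0 1) z * inner_RN N p z\<bar>
          \<le> (H + P) * ?r powr q"
        unfolding distrib_right by linarith
      then show "\<bar>(w (x + z, t) - w (x, t)
            - I_ind \<sigma> * indicator (ball_RN N 0 1) z * inner_RN N p z) * K z\<bar>
          \<le> (H + P) * (?r powr q * K z)"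
        using Kz by (simp add: abs_mult mult.assoc[symmetric] mult_right_mono)
    qed (use C(1) H P0 in \<open>auto\<close>)
  qed
qed

section \<open>Semicontinuity, measurability and the comparison of outer parts\<close>

lemma usc_on_uminus_iff: "usc_on S (\<lambda>q. - f q) \<longleftrightarrow> lsc_on S f"
proof -
  have "{q \<in> S. - f q < c} = {q \<in> S. - c < f q}" for c
    by (auto simp: minus_less_iff)
  then show ?thesis
    unfolding usc_on_def lsc_on_def by (metis minus_minus)
qed

lemma continuous_on_translation_RN: "continuous_on S (\<lambda>z::vec. x + z)"
  by (rule continuous_on_coordinatewise_then_product)
    (auto intro!: continuous_intros continuous_on_coordinate)

text \<open>Sublevel sets of a section are relatively open in the closed set \<open>RN N\<close>,
  hence Borel. The indicator is there because nothing is known about u away from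
  \<open>RN N\<close>.\<close>

lemma usc_section_measurable:
  assumes u: "usc_on (QT_bar N T) u" and x: "x \<in> RN N" and t: "t \<in> {0..T}"
  shows "(\<lambda>z. indicator (RN N) z * u (x + z, t)) \<in> borel_measurable (lebesgue_RN N)"
proof (rule borel_measurable_lebesgue_RN, rule borel_measurableI_less)
  fix c :: real
  have "openin (top_of_set (QT_bar N T)) {q \<in> QT_bar N T. u q < c}"
    using u by (simp add: usc_on_def)
  then have "openin (top_of_set (RN N))
      (RN N \<inter> (\<lambda>z. (x + z, t)) -` {q \<in> QT_bar N T. u q < c})"
    using x t by (intro continuous_openin_preimage[where T = "QT_bar N T"])
      (auto simp: QT_bar_def RN_closed_add intro!: continuous_intros continuous_on_translation_RN)
  also have "RN N \<inter> (\<lambda>z. (x + z, t)) -` {q \<in> QT_bar N T. u q < c} = {z \<in> RN N. u (x + z, t) < c}"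
    using x t by (auto simp: QT_bar_def RN_closed_add)
  finally obtain U where "open U" and U: "{z \<in> RN N. u (x + z, t) < c} = RN N \<inter> U"
    by (auto simp: openin_open)
  \<comment> \<open>Off \<open>RN N\<close> the function is 0, which lies below c exactly when c is
    positive.\<close>
  have "{z. indicator (RN N) z * u (x + z, t) < c} = (RN N \<inter> U) \<union> (if 0 < c then - RN N else {})"
    unfolding U[symmetric] by (auto simp: indicator_def split: if_splits)
  then show "{z \<in> space borel. indicator (RN N) z * u (x + z, t) < c} \<in> sets borel"
    using \<open>open U\<close> closed_RN[of N] by auto
qed

text \<open>Two integrals are subtracted, so integrability has to be established and the default
  value 0 is of no help. The same e bounds the excess of the increments of u over those of v and the
  gap between the gradients, whence the factor 2 e; the rest is the mass of the kernel outside the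
  ball.\<close>

lemma I_far_compare:
  assumes K: "admissible_kernel N \<sigma> K" and \<sigma>: "0 < \<sigma>"
  obtains C where "0 \<le> C" and
    "\<And>T u v M (\<delta>::real) e p p' x t y s. \<lbrakk>usc_on (QT_bar N T) u; lsc_on (QT_bar N T) v;
      \<And>q. q \<in> QT_bar N T \<Longrightarrow> \<bar>u q\<bar> \<le> M; \<And>q. q \<in> QT_bar N T \<Longrightarrow> \<bar>v q\<bar> \<le> M;
      x \<in> RN N; y \<in> RN N; t \<in> {0..T}; s \<in> {0..T}; 0 < \<delta>; norm_RN N (p - p') \<le> e;
      \<And>z. z \<in> RN N \<Longrightarrow> u (x + z, t) - u (x, t) - (v (y + z, s) - v (y, s)) \<le> e\<rbrakk>
      \<Longrightarrow> I_far N \<sigma> K \<delta> u p x t - I_far N \<sigma> K \<delta> v p' y s \<le> 2 * e * (C * \<delta> powr (- \<sigma>))"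
proof -
  obtain C where C: "0 \<le> C" "\<And>\<delta>::real. 0 < \<delta> \<Longrightarrow>
    (\<integral>\<^sup>+z. ennreal (indicator (RN N - ball_RN N 0 \<delta>) z * (norm_RN N z powr 0 * K z))
        \<partial>lebesgue_RN N)
      \<le> ennreal (C * \<delta> powr (0 - \<sigma>))"
    using kernel_moment_far[OF K \<sigma>] by blast
  note [measurable] = admissible_kernel_measurable[OF K]
  show thesis
  proof (rule that[OF C(1)])
    fix T M \<delta> e t s :: real and u v :: "point \<Rightarrow> real" and p p' x y :: vec
    assume u: "usc_on (QT_bar N T) u" and v: "lsc_on (QT_bar N T) v"
      and uM: "\<And>q. q \<in> QT_bar N T \<Longrightarrow> \<bar>u q\<bar> \<le> M" and vM: "\<And>q. q \<in> QT_bar N T \<Longrightarrow> \<bar>v q\<bar> \<le> M"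
      and x: "x \<in> RN N" and y: "y \<in> RN N" and t: "t \<in> {0..T}" and s: "s \<in> {0..T}"
      and \<delta>: "0 < \<delta>" and p: "norm_RN N (p - p') \<le> e"
      and uv: "\<And>z. z \<in> RN N \<Longrightarrow> u (x + z, t) - u (x, t) - (v (y + z, s) - v (y, s)) \<le> e"
    define S where "S = RN N - ball_RN N 0 \<delta>"
    have e0: "0 \<le> e"
      using p norm_RN_nonneg order_trans by blast
    have [measurable]: "S \<in> sets (lebesgue_RN N)"
      unfolding S_def by measurable
    have S: "z \<in> RN N" "0 < norm_RN N z" "0 \<le> K z" if "z \<in> S" for z
      using that \<delta> admissible_kernel_nonneg[OF K] by (auto simp: S_def ball_RN_def)
    \<comment> \<open>The factor \<open>norm_RN N z powr 0\<close> is 1 only for z different from 0,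
      and S omits the origin.\<close>
    have KS: "(\<integral>\<^sup>+z. ennreal (indicator S z * K z) \<partial>lebesgue_RN N) \<le> ennreal (C * \<delta> powr (- \<sigma>))"
    proof -
      have "(\<integral>\<^sup>+z. ennreal (indicator S z * K z) \<partial>lebesgue_RN N)
        = (\<integral>\<^sup>+z. ennreal (indicator S z * (norm_RN N z powr 0 * K z)) \<partial>lebesgue_RN N)"
        by (rule nn_integral_cong) (use S(2) in \<open>force simp: indicator_def\<close>)
      then show ?thesis
        using C(2)[OF \<delta>] by (simp add: S_def)
    qed
    have intK: "integrable (lebesgue_RN N) (\<lambda>z. indicator S z * K z)"
    proof (rule integrableI_nonneg)
      show "(\<integral>\<^sup>+z. ennreal (indicator S z * K z) \<partial>lebesgue_RN N) < \<infinity>"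
        using KS by (rule le_less_trans) simp
      show "AE z in lebesgue_RN N. 0 \<le> indicator S z * K z"
        by (rule AE_I2) (use S in \<open>auto simp: indicator_def\<close>)
    qed measurable
    have intK_le: "(LINT z|lebesgue_RN N. indicator S z * K z) \<le> C * \<delta> powr (- \<sigma>)"
    proof -
      have "ennreal (LINT z|lebesgue_RN N. indicator S z * K z)
          = (\<integral>\<^sup>+z. ennreal (indicator S z * K z) \<partial>lebesgue_RN N)"
        by (intro nn_integral_eq_integral[symmetric] intK AE_I2)
          (use S in \<open>auto simp: indicator_def\<close>)
      with KS have "ennreal (LINT z|lebesgue_RN N. indicator S z * K z) \<le> ennreal (C * \<delta> powr (- \<sigma>))"
        by metis
      then show ?thesis
        using C(1) by (subst (asm) ennreal_le_iff) auto
    qed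
    have integrable_far: "integrable (lebesgue_RN N) (\<lambda>z. indicator S z *\<^sub>R
        ((w (x + z, t) - w (x, t) - I_ind \<sigma> * indicator (ball_RN N 0 1) z * inner_RN N p z) * K z))"
      if meas: "(\<lambda>z. indicator (RN N) z * w (x + z, t)) \<in> borel_measurable (lebesgue_RN N)"
        and wM: "\<And>q. q \<in> QT_bar N T \<Longrightarrow> \<bar>w q\<bar> \<le> M" and x: "x \<in> RN N" and t: "t \<in> {0..T}"
      for w :: "point \<Rightarrow> real" and x t p
    proof (rule Bochner_Integration.integrable_bound)
      show "integrable (lebesgue_RN N) (\<lambda>z. (2 * M + norm_RN N p) * (indicator S z * K z))"
        by (intro integrable_mult_right intK)
      \<comment> \<open>On S the section of w may be replaced by its cut-off to \<open>RN N\<close>,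
        which is the function known to be measurable.\<close>
      have eq: "(\<lambda>z. indicator S z *\<^sub>R
          ((w (x + z, t) - w (x, t) - I_ind \<sigma> * indicator (ball_RN N 0 1) z * inner_RN N p z) * K z))
        = (\<lambda>z. indicator S z *\<^sub>R ((indicator (RN N) z * w (x + z, t) - w (x, t)
            - I_ind \<sigma> * indicator (ball_RN N 0 1) z * inner_RN N p z) * K z))"
        using S by (auto simp: fun_eq_iff indicator_def)
      note [measurable] = meas
      show "(\<lambda>z. indicator S z *\<^sub>R
          ((w (x + z, t) - w (x, t) - I_ind \<sigma> * indicator (ball_RN N 0 1) z * inner_RN N p z) * K z))
          \<in> borel_measurable (lebesgue_RN N)"
        unfolding eq by measurable
      show "AE z in lebesgue_RN N. norm (indicator S z *\<^sub>R
          ((w (x + z, t) - w (x, t) - I_ind \<sigma> * indicator (ball_RN N 0 1) z * inner_RN N p z) * K z))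
          \<le> norm ((2 * M + norm_RN N p) * (indicator S z * K z))"
      proof (rule AE_I2)
        fix z
        have M0: "0 \<le> M"
          using wM[of "(x, t)"] x t by (auto simp: QT_bar_def)
        show "norm (indicator S z *\<^sub>R
          ((w (x + z, t) - w (x, t) - I_ind \<sigma> * indicator (ball_RN N 0 1) z * inner_RN N p z) * K z))
          \<le> norm ((2 * M + norm_RN N p) * (indicator S z * K z))"
        proof (cases "z \<in> S")
          case True
          have "\<bar>w (x + z, t)\<bar> \<le> M" "\<bar>w (x, t)\<bar> \<le> M"
            using wM x t S(1)[OF True] by (auto simp: QT_bar_def RN_closed_add)
          moreover have "\<bar>I_ind \<sigma> * indicator (ball_RN N 0 1) z * inner_RN N p z\<bar> \<le> norm_RN N p"
          proof (cases "z \<in> ball_RN N 0 1")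
            case in_ball: True
            have "\<bar>inner_RN N p z\<bar> \<le> norm_RN N p * norm_RN N z"
              by (rule abs_inner_RN_le)
            also have "\<dots> \<le> norm_RN N p * 1"
              using in_ball by (intro mult_left_mono) (auto simp: ball_RN_def)
            finally show ?thesis
              using in_ball by (simp add: I_ind_def)
          qed simp
          ultimately have "\<bar>w (x + z, t) - w (x, t)
              - I_ind \<sigma> * indicator (ball_RN N 0 1) z * inner_RN N p z\<bar> \<le> 2 * M + norm_RN N p"
            by linarith
          then show ?thesis
            using True S(3)[OF True] M0 by (simp add: abs_mult mult_right_mono)
        qed simp
      qed
    qed
    have iu: "integrable (lebesgue_RN N) (\<lambda>z. indicator S z *\<^sub>R
        ((u (x + z, t) - u (x, t) - I_ind \<sigma> * indicator (ball_RN N 0 1) z * inner_RN N p z) * K z))"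
      by (intro integrable_far usc_section_measurable[OF u] uM x t)
    have "(\<lambda>z. indicator (RN N) z * - v (y + z, s)) \<in> borel_measurable (lebesgue_RN N)"
      using usc_section_measurable[of N T "\<lambda>q. - v q", OF _ y s] v by (simp add: usc_on_uminus_iff)
    then have "(\<lambda>z. indicator (RN N) z * v (y + z, s)) \<in> borel_measurable (lebesgue_RN N)"
      by (subst (asm) borel_measurable_uminus_eq[symmetric]) simp
    then have iv: "integrable (lebesgue_RN N) (\<lambda>z. indicator S z *\<^sub>R
        ((v (y + z, s) - v (y, s) - I_ind \<sigma> * indicator (ball_RN N 0 1) z * inner_RN N p' z) * K z))"
      by (intro integrable_far vM y s)
    have "I_far N \<sigma> K \<delta> u p x t - I_far N \<sigma> K \<delta> v p' y s
      = (LINT z|lebesgue_RN N. indicator S z *\<^sub>R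
        ((u (x + z, t) - u (x, t) - I_ind \<sigma> * indicator (ball_RN N 0 1) z * inner_RN N p z) * K z)
        - indicator S z *\<^sub>R
        ((v (y + z, s) - v (y, s) - I_ind \<sigma> * indicator (ball_RN N 0 1) z * inner_RN N p' z) * K z))"
      unfolding I_far_def set_lebesgue_integral_def S_def[symmetric]
      by (rule Bochner_Integration.integral_diff[OF iu iv, symmetric])
    also have "\<dots> \<le> (LINT z|lebesgue_RN N. 2 * e * (indicator S z * K z))"
    proof (rule integral_mono)
      fix z
      show "indicator S z *\<^sub>R
        ((u (x + z, t) - u (x, t) - I_ind \<sigma> * indicator (ball_RN N 0 1) z * inner_RN N p z) * K z)
        - indicator S z *\<^sub>R
        ((v (y + z, s) - v (y, s) - I_ind \<sigma> * indicator (ball_RN N 0 1) z * inner_RN N p' z) * K z)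
        \<le> 2 * e * (indicator S z * K z)"
      proof (cases "z \<in> S")
        case True
        have "\<bar>I_ind \<sigma> * indicator (ball_RN N 0 1) z * inner_RN N (p - p') z\<bar> \<le> e"
        proof (cases "z \<in> ball_RN N 0 1")
          case in_ball: True
          have "\<bar>inner_RN N (p - p') z\<bar> \<le> norm_RN N (p - p') * norm_RN N z"
            by (rule abs_inner_RN_le)
          also have "\<dots> \<le> e * 1"
            using in_ball p e0 by (intro mult_mono) (auto simp: ball_RN_def)
          finally show ?thesis
            using in_ball e0 by (simp add: I_ind_def)
        qed (use e0 in simp)
        moreover have "inner_RN N (p - p') z = inner_RN N p z - inner_RN N p' z"
          by (simp add: inner_RN_def sum_subtractf left_diff_distrib)
        ultimately have "(u (x + z, t) - u (x, t)
              - I_ind \<sigma> * indicator (ball_RN N 0 1) z * inner_RN N p z)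
            - (v (y + z, s) - v (y, s)
              - I_ind \<sigma> * indicator (ball_RN N 0 1) z * inner_RN N p' z) \<le> 2 * e"
          using uv[OF S(1)[OF True]] by (simp add: right_diff_distrib)
        from mult_right_mono[OF this S(3)[OF True]] show ?thesis
          using True by (simp add: left_diff_distrib)
      qed simp
    qed (use iu iv intK in \<open>auto intro!: Bochner_Integration.integrable_diff\<close>)
    also have "\<dots> = 2 * e * (LINT z|lebesgue_RN N. indicator S z * K z)"
      by simp
    also have "\<dots> \<le> 2 * e * (C * \<delta> powr (- \<sigma>))"
      using e0 by (intro mult_left_mono intK_le) auto
    finally show "I_far N \<sigma> K \<delta> u p x t - I_far N \<sigma> K \<delta> v p' y s \<le> 2 * e * (C * \<delta> powr (- \<sigma>))" .
  qed
qed

section \<open>Maxima of the doubled functional\<close>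

text \<open>Otherwise the relatively open sets where f < f q, for q in A, cover A. A finite subcover
  belongs to finitely many q, and the one with the largest value lies in none of its sets.\<close>

lemma usc_on_attains_max:
  assumes f: "usc_on S f" and A: "compact A" "A \<subseteq> S" "A \<noteq> {}"
  obtains p where "p \<in> A" "\<And>q. q \<in> A \<Longrightarrow> f q \<le> f p"
proof -
  have "\<exists>p\<in>A. \<forall>q\<in>A. f q \<le> f p"
  proof (rule ccontr)
    assume "\<not> ?thesis"
    then have ex: "\<exists>q\<in>A. f p < f q" if "p \<in> A" for p
      using that by (auto simp: not_le)
    have "\<exists>U. open U \<and> {p \<in> S. f p < f q} = S \<inter> U" for q
      using f by (auto simp: usc_on_def openin_open)
    then obtain U where U: "\<And>q. open (U q)" "\<And>q. {p \<in> S. f p < f q} = S \<inter> U q"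
      by metis
    have "A \<subseteq> (\<Union>q\<in>A. U q)"
    proof
      fix p assume "p \<in> A"
      then show "p \<in> (\<Union>q\<in>A. U q)"
        using ex[of p] U(2) A(2) by blast
    qed
    then obtain Q where Q: "Q \<subseteq> A" "finite Q" "A \<subseteq> (\<Union>q\<in>Q. U q)"
      using compactE_image[OF A(1), of A U] U(1) by blast
    have "Q \<noteq> {}"
      using Q(3) A(3) by auto
    then have "Max (f ` Q) \<in> f ` Q"
      using Q(2) by (intro Max_in) auto
    then obtain q where q: "q \<in> Q" "Max (f ` Q) = f q"
      by blast
    have max: "f r \<le> f q" if "r \<in> Q" for r
      using Q(2) that by (simp add: q(2)[symmetric])
    obtain r where "r \<in> Q" "q \<in> U r"
      using Q q(1) by blast
    then have "f q < f r"
      using U(2)[of r] q(1) Q(1) A(2) by blast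
    then show False
      using max[OF \<open>r \<in> Q\<close>] by simp
  qed
  then show ?thesis
    using that by blast
qed

lemma usc_on_add:
  assumes f: "usc_on S f" and g: "usc_on S g"
  shows "usc_on S (\<lambda>p. f p + g p)"
  unfolding usc_on_def
proof
  fix c
  have "{p \<in> S. f p + g p < c} = (\<Union>r. {p \<in> S. f p < r} \<inter> {p \<in> S. g p < c - r})"
  proof (intro set_eqI iffI)
    fix p assume "p \<in> {p \<in> S. f p + g p < c}"
    \<comment> \<open>The separating r is the midpoint of f p and c - g p.\<close>
    then have "p \<in> {p \<in> S. f p < (f p + c - g p) / 2} \<inter> {p \<in> S. g p < c - (f p + c - g p) / 2}"
      by (auto simp: field_simps)
    then show "p \<in> (\<Union>r. {p \<in> S. f p < r} \<inter> {p \<in> S. g p < c - r})"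
      by blast
  qed auto
  moreover have "openin (top_of_set S) (\<Union>r. {p \<in> S. f p < r} \<inter> {p \<in> S. g p < c - r})"
    using f g by (intro openin_Union openin_Int) (auto simp: usc_on_def)
  ultimately show "openin (top_of_set S) {p \<in> S. f p + g p < c}"
    by simp
qed

lemma usc_on_compose:
  assumes f: "usc_on S f" and h: "continuous_on R h" "h ` R \<subseteq> S"
  shows "usc_on R (\<lambda>p. f (h p))"
  unfolding usc_on_def
proof
  fix c
  have "openin (top_of_set R) (R \<inter> h -` {q \<in> S. f q < c})"
    using f h by (intro continuous_openin_preimage[where T = S]) (auto simp: usc_on_def)
  moreover have "R \<inter> h -` {q \<in> S. f q < c} = {p \<in> R. f (h p) < c}"
    using h by auto
  ultimately show "openin (top_of_set R) {p \<in> R. f (h p) < c}"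
    by simp
qed

lemma continuous_on_imp_usc_on: "continuous_on S f \<Longrightarrow> usc_on S f" for f :: "_ \<Rightarrow> real"
  unfolding usc_on_def
proof
  fix c assume "continuous_on S f"
  then have "openin (top_of_set S) (S \<inter> f -` {..<c})"
    by (intro continuous_openin_preimage_gen) auto
  moreover have "S \<inter> f -` {..<c} = {q \<in> S. f q < c}"
    by auto
  ultimately show "openin (top_of_set S) {q \<in> S. f q < c}"
    by simp
qed

text \<open>A box is a product of compact intervals and singletons {0}, so Tychonoff's theorem gives
  compactness in the product topology, and leaving it is visible in one coordinate.\<close>

definition box_RN :: "nat \<Rightarrow> vec \<Rightarrow> vec set" where
  "box_RN N a = {x \<in> RN N. \<forall>i<N. \<bar>x i - a i\<bar> \<le> 1}"

lemma compact_box_RN: "compact (box_RN N a)"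
proof -
  have "box_RN N a = Pi\<^sub>E UNIV (\<lambda>i. if i < N then {a i - 1..a i + 1} else {0})"
  proof (intro set_eqI iffI)
    fix x assume "x \<in> Pi\<^sub>E UNIV (\<lambda>i. if i < N then {a i - 1..a i + 1} else {0})"
    then have "x i \<in> (if i < N then {a i - 1..a i + 1} else {0})" for i
      by (rule PiE_mem) simp
    then have "i < N \<Longrightarrow> x i \<in> {a i - 1..a i + 1}" "N \<le> i \<Longrightarrow> x i = 0" for i
      by (metis, metis not_less singletonD)
    then show "x \<in> box_RN N a"
      by (force simp: box_RN_def RN_def abs_le_iff)
  next
    fix x assume "x \<in> box_RN N a"
    then have "x i \<in> (if i < N then {a i - 1..a i + 1} else {0})" for i
      by (force simp: box_RN_def RN_def abs_le_iff)
    then show "x \<in> Pi\<^sub>E UNIV (\<lambda>i. if i < N then {a i - 1..a i + 1} else {0})"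
      by (simp add: PiE_UNIV_domain Pi_iff)
  qed
  moreover have "compact (Pi\<^sub>E UNIV (\<lambda>i. if i < N then {a i - 1..a i + 1} else {0}))"
    using compactin_PiE[of "\<lambda>_::nat. euclideanreal" UNIV "\<lambda>i. if i < N then {a i - 1..a i + 1} else {0}"]
    by (auto simp: euclidean_product_topology)
  ultimately show ?thesis
    by simp
qed

text \<open>The linear term carries only t, so \<eta> appears in just one of the two time
  derivatives and survives their subtraction.\<close>

definition doubled ::
  "nat \<Rightarrow> (point \<Rightarrow> real) \<Rightarrow> (point \<Rightarrow> real) \<Rightarrow> real \<Rightarrow> real \<Rightarrow> real \<Rightarrow> vec \<Rightarrow> vec
    \<Rightarrow> vec \<Rightarrow> real \<Rightarrow> vec \<Rightarrow> real \<Rightarrow> real" where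
  "doubled N u v \<epsilon> \<eta> \<beta> a b x t y s = u (x, t) - v (y, s) - (norm_RN N (x - y))\<^sup>2 / \<epsilon> - (t - s)\<^sup>2 / \<epsilon>
     - \<eta> * t - \<beta> * (bump N a x + bump N b y)"

lemma usc_on_doubled:
  assumes u: "usc_on (QT_bar N T) u" and v: "usc_on (QT_bar N T) (\<lambda>q. - v q)"
  shows "usc_on (QT_bar N T \<times> QT_bar N T) (\<lambda>((x, t), (y, s)). doubled N u v \<epsilon> \<eta> \<beta> a b x t y s)"
proof -
  have 1: "continuous_on R (\<lambda>p::point \<times> point. fst (fst p) i)" for i and R
    using continuous_on_compose2[of UNIV "\<lambda>x. x i" R "\<lambda>p. fst (fst p)"] continuous_on_coordinate
    by (simp add: continuous_on_fst)
  have 2: "continuous_on R (\<lambda>p::point \<times> point. fst (snd p) i)" for i and R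
    using continuous_on_compose2[of UNIV "\<lambda>x. x i" R "\<lambda>p. fst (snd p)"] continuous_on_coordinate
    by (simp add: continuous_on_fst continuous_on_snd)
  have bump1: "continuous_on UNIV bump1"
    using DERIV_bump1 by (meson DERIV_continuous_on has_field_derivative_at_within)
  let ?Q = "QT_bar N T \<times> QT_bar N T"
  have "usc_on ?Q (\<lambda>p. u (fst p))"
    by (rule usc_on_compose[OF u]) (auto intro!: continuous_intros)
  moreover have "usc_on ?Q (\<lambda>p. - v (snd p))"
    by (rule usc_on_compose[OF v]) (auto intro!: continuous_intros)
  \<comment> \<open>Multiplying by \<open>inverse \<epsilon>\<close> in place of dividing makes
    continuity immediate for every \<epsilon>.\<close>
  moreover have "usc_on ?Q (\<lambda>p. - ((\<Sum>i<N. (fst (fst p) i - fst (snd p) i)\<^sup>2) * inverse \<epsilon>)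
      - (snd (fst p) - snd (snd p))\<^sup>2 * inverse \<epsilon> - \<eta> * snd (fst p)
      - \<beta> * ((\<Sum>i<N. bump1 (fst (fst p) i - a i)) + (\<Sum>i<N. bump1 (fst (snd p) i - b i))))"
    by (intro continuous_on_imp_usc_on continuous_intros 1 2 continuous_on_compose2[OF bump1]) auto
  ultimately have "usc_on ?Q (\<lambda>p. u (fst p) + (- v (snd p)
      + (- ((\<Sum>i<N. (fst (fst p) i - fst (snd p) i)\<^sup>2) * inverse \<epsilon>)
      - (snd (fst p) - snd (snd p))\<^sup>2 * inverse \<epsilon> - \<eta> * snd (fst p)
      - \<beta> * ((\<Sum>i<N. bump1 (fst (fst p) i - a i)) + (\<Sum>i<N. bump1 (fst (snd p) i - b i))))))"
    by (intro usc_on_add)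
  then show ?thesis
    by (simp add: doubled_def case_prod_unfold norm_RN_power2 bump_def divide_inverse algebra_simps)
qed

text \<open>
  The bumps are centred at a point where the functional without bumps is within \<open>\<beta>/4\<close> of its
  supremum. Leaving the unit boxes around the centres costs at least \<open>\<beta>/2\<close>, so the supremum of the
  perturbed functional is attained in these compact boxes.
\<close>

lemma doubled_attains_max:
  assumes u: "usc_on (QT_bar N T) u" and v: "lsc_on (QT_bar N T) v"
    and uM: "\<And>q. q \<in> QT_bar N T \<Longrightarrow> \<bar>u q\<bar> \<le> M" and vM: "\<And>q. q \<in> QT_bar N T \<Longrightarrow> \<bar>v q\<bar> \<le> M"
    and pos: "0 < T" "0 < \<epsilon>" "0 < \<beta>" "0 \<le> \<eta>"
  obtains a b x t y s where "x \<in> RN N" "y \<in> RN N" "t \<in> {0..T}" "s \<in> {0..T}"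
    and "\<And>x' t' y' s'. \<lbrakk>x' \<in> RN N; y' \<in> RN N; t' \<in> {0..T}; s' \<in> {0..T}\<rbrakk> \<Longrightarrow>
      doubled N u v \<epsilon> \<eta> \<beta> a b x' t' y' s' \<le> doubled N u v \<epsilon> \<eta> \<beta> a b x t y s"
proof -
  let ?Q = "QT_bar N T \<times> QT_bar N T"
  define f where "f = (\<lambda>((x, t), (y, s)). doubled N u v \<epsilon> \<eta> 0 0 0 x t y s)"
  have bdd: "bdd_above (f ` ?Q)"
  proof (rule bdd_aboveI2)
    fix q assume "q \<in> ?Q"
    then obtain x t y s where q: "q = ((x, t), (y, s))" "(x, t) \<in> QT_bar N T" "(y, s) \<in> QT_bar N T"
      by (metis mem_Times_iff prod.collapse)
    have "0 \<le> (norm_RN N (x - y))\<^sup>2 / \<epsilon>" "0 \<le> (t - s)\<^sup>2 / \<epsilon>" "0 \<le> \<eta> * t"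
      using pos q by (auto simp: QT_bar_def)
    then show "f q \<le> 2 * M"
      using uM[OF q(2)] vM[OF q(3)] by (simp add: q(1) f_def doubled_def)
  qed
  have "((0, 0), (0, 0)) \<in> ?Q"
    using pos zero_in_RN by (simp add: QT_bar_def)
  then have "f ` ?Q \<noteq> {}"
    by blast
  then have "\<exists>q\<in>f ` ?Q. Sup (f ` ?Q) - \<beta> / 4 < q"
    using pos by (intro less_cSupD) auto
  then obtain a ta b tb where ab: "((a, ta), (b, tb)) \<in> ?Q"
    and near: "Sup (f ` ?Q) - \<beta> / 4 < f ((a, ta), (b, tb))"
    by fastforce
  define g where "g = (\<lambda>((x, t), (y, s)). doubled N u v \<epsilon> \<eta> \<beta> a b x t y s)"
  define A where "A = (box_RN N a \<times> {0..T}) \<times> (box_RN N b \<times> {0..T})"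
  have abA: "((a, ta), (b, tb)) \<in> A"
    using ab by (simp add: A_def QT_bar_def box_RN_def)
  obtain p where p: "p \<in> A" "\<And>q. q \<in> A \<Longrightarrow> g q \<le> g p"
  proof (rule usc_on_attains_max[of ?Q g A])
    show "usc_on ?Q g"
      unfolding g_def using u v by (intro usc_on_doubled) (simp_all add: usc_on_uminus_iff)
    show "compact A"
      unfolding A_def by (intro compact_Times compact_box_RN) auto
    show "A \<subseteq> ?Q"
      by (auto simp: A_def QT_bar_def box_RN_def)
    show "A \<noteq> {}"
      using abA by auto
  qed (use that in blast)
  obtain x t y s where xy: "p = ((x, t), (y, s))"
    by (metis prod.collapse)
  have gf: "g ((x', t'), (y', s')) = f ((x', t'), (y', s')) - \<beta> * (bump N a x' + bump N b y')"
    for x' t' y' s'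
    by (simp add: g_def f_def doubled_def)
  show thesis
  proof (rule that[of x y t s a b])
    show "x \<in> RN N" "y \<in> RN N" "t \<in> {0..T}" "s \<in> {0..T}"
      using p(1) by (auto simp: xy A_def box_RN_def)
    fix x' t' y' s'
    assume "x' \<in> RN N" "y' \<in> RN N" "t' \<in> {0..T}" "s' \<in> {0..T}"
    then have q: "((x', t'), (y', s')) \<in> ?Q"
      by (simp add: QT_bar_def)
    have "g ((x', t'), (y', s')) \<le> g p"
    proof (cases "((x', t'), (y', s')) \<in> A")
      case False
      then have "(\<exists>i<N. 1 \<le> \<bar>x' i - a i\<bar>) \<or> (\<exists>i<N. 1 \<le> \<bar>y' i - b i\<bar>)"
        using q by (auto simp: A_def QT_bar_def box_RN_def not_le intro: less_imp_le)
      then have "1 / 2 \<le> bump N a x' + bump N b y'"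
        using bump_ge_half[of _ N x' a] bump_ge_half[of _ N y' b]
          bump_bounds(1)[of N a x'] bump_bounds(1)[of N b y'] by fastforce
      then have "\<beta> * (1 / 2) \<le> \<beta> * (bump N a x' + bump N b y')"
        using pos by (intro mult_left_mono) auto
      then have "g ((x', t'), (y', s')) \<le> f ((x', t'), (y', s')) - \<beta> / 2"
        by (simp add: gf)
      also have "f ((x', t'), (y', s')) \<le> Sup (f ` ?Q)"
        using q bdd by (intro cSup_upper) auto
      also have "Sup (f ` ?Q) - \<beta> / 2 \<le> f ((a, ta), (b, tb))"
        using near pos by linarith
      also have "\<dots> = g ((a, ta), (b, tb))"
        by (simp add: gf)
      also have "\<dots> \<le> g p"
        by (rule p(2)[OF abA])
      finally show ?thesis
        by simp
    qed (rule p(2))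
    then show "doubled N u v \<epsilon> \<eta> \<beta> a b x' t' y' s' \<le> doubled N u v \<epsilon> \<eta> \<beta> a b x t y s"
      by (simp add: xy g_def)
  qed
qed

section \<open>The viscosity inequalities at a maximum\<close>

lemma penalty_grad_norm_le:
  assumes "0 < \<epsilon>" "0 \<le> \<beta>" "\<beta> \<le> 1"
  shows "norm_RN N (penalty_grad N \<epsilon> \<beta> c a x) \<le> 2 * norm_RN N (x - c) / \<epsilon> + real N"
proof -
  define g where "g i = \<beta> * bump1' (x i - a i)" for i
  define f where "f i = 2 / \<epsilon> * (x i - c i)" for i
  have "norm_RN N (penalty_grad N \<epsilon> \<beta> c a x) = norm_RN N (f + g)"
    by (simp add: norm_RN_def L2_set_def penalty_grad_def f_def g_def)
  also have "\<dots> \<le> norm_RN N f + norm_RN N g"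
    by (rule norm_RN_triangle)
  also have "norm_RN N f = 2 * norm_RN N (x - c) / \<epsilon>"
    using assms L2_set_right_distrib[of "2 / \<epsilon>" "x - c" "{..<N}"]
    by (simp add: norm_RN_def f_def[abs_def])
  also have "norm_RN N g \<le> (\<Sum>i<N. \<bar>g i\<bar>)"
    by (rule norm_RN_le_sum_abs)
  also have "\<dots> \<le> (\<Sum>i<N. 1)"
    using assms abs_bump1'_le by (intro sum_mono) (simp add: g_def abs_mult mult_le_one)
  finally show ?thesis
    by (simp add: fun_diff_def)
qed

text \<open>The quadratic contributions to both gradients are 2 (x - y) / \<epsilon> and cancel
  exactly; only the slopes of the bumps remain, at most 2 \<beta> in each coordinate.\<close>

lemma penalty_grad_opposite:
  assumes "0 \<le> \<beta>"
  shows "norm_RN N (penalty_grad N \<epsilon> \<beta> y a x - - penalty_grad N \<epsilon> \<beta> x b y) \<le> 2 * real N * \<beta>"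
proof -
  have "norm_RN N (penalty_grad N \<epsilon> \<beta> y a x - - penalty_grad N \<epsilon> \<beta> x b y)
      \<le> (\<Sum>i<N. \<bar>(penalty_grad N \<epsilon> \<beta> y a x - - penalty_grad N \<epsilon> \<beta> x b y) i\<bar>)"
    by (rule norm_RN_le_sum_abs)
  also have "\<dots> \<le> (\<Sum>i<N. 2 * \<beta>)"
  proof (rule sum_mono)
    fix i assume "i \<in> {..<N}"
    then have "(penalty_grad N \<epsilon> \<beta> y a x - - penalty_grad N \<epsilon> \<beta> x b y) i
        = \<beta> * (bump1' (x i - a i) + bump1' (y i - b i))"
      by (simp add: penalty_grad_def algebra_simps add_divide_distrib[symmetric] diff_divide_distrib)
    moreover have "\<bar>bump1' (x i - a i) + bump1' (y i - b i)\<bar> \<le> 2"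
      using abs_bump1'_le[of "x i - a i"] abs_bump1'_le[of "y i - b i"] by linarith
    ultimately show "\<bar>(penalty_grad N \<epsilon> \<beta> y a x - - penalty_grad N \<epsilon> \<beta> x b y) i\<bar> \<le> 2 * \<beta>"
      using assms by (simp add: abs_mult mult_left_mono mult.commute)
  qed
  finally show ?thesis
    by (simp add: mult_ac)
qed

text \<open>With (y,s) frozen, u - \<phi>u is maximal at (x,t); with (x,t) frozen, v - \<phi>v is
  minimal at (y,s). The time derivatives of the tests are 2 (t - s) / \<epsilon> + \<eta> and 2 (t -
  s) / \<epsilon>, so subtracting the two inequalities isolates \<eta>. The maximum is global, which
  leaves the radius \<delta> free. The factors 1, -1 and 0 in the tests match
  \<open>C2_QT_penalty\<close>.\<close>

lemma viscosity_doubling: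
  assumes u: "viscosity_subsolution N \<sigma> K F T u" and v: "viscosity_supersolution N \<sigma> K F T v"
    and x: "x \<in> RN N" and y: "y \<in> RN N" and t: "t \<in> {0<..T}" and s: "s \<in> {0<..T}"
    and \<delta>: "0 < \<delta>" "\<delta> < 1"
    and max: "\<And>x' t' y' s'. \<lbrakk>x' \<in> RN N; y' \<in> RN N; t' \<in> {0..T}; s' \<in> {0..T}\<rbrakk> \<Longrightarrow>
      doubled N u v \<epsilon> \<eta> \<beta> a b x' t' y' s' \<le> doubled N u v \<epsilon> \<eta> \<beta> a b x t y s"
    and pu: "pu = penalty_grad N \<epsilon> \<beta> y a x" and pv: "pv = - penalty_grad N \<epsilon> \<beta> x b y"
    and \<phi>u: "\<phi>u = (\<lambda>(x', t'). 1 * penalty N \<epsilon> \<beta> y a x' + (1 / \<epsilon> * (t' - s)\<^sup>2 + \<eta> * t'))"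
    and \<phi>v: "\<phi>v = (\<lambda>(y', s'). (-1) * penalty N \<epsilon> \<beta> x b y' + (- 1 / \<epsilon> * (s' - t)\<^sup>2 + 0 * s'))"
  shows "\<eta> \<le> F y pv (I_near N \<sigma> K \<delta> \<phi>v pv y s + I_far N \<sigma> K \<delta> v pv y s)
    - F x pu (I_near N \<sigma> K \<delta> \<phi>u pu x t + I_far N \<sigma> K \<delta> u pu x t)"
proof -
  have eq: "doubled N u v \<epsilon> \<eta> \<beta> a b x' t' y s = u (x', t') - \<phi>u (x', t') - v (y, s) - \<beta> * bump N b y"
    for x' t'
    by (simp add: doubled_def \<phi>u penalty_def algebra_simps)
  have eq': "doubled N u v \<epsilon> \<eta> \<beta> a b x t y' s'
      = u (x, t) - \<eta> * t - \<beta> * bump N a x - (v (y', s') - \<phi>v (y', s'))" for y' s'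
    by (simp add: doubled_def \<phi>v penalty_def algebra_simps norm_RN_minus_commute[of N x y']
        power2_commute[of t s'])
  define Du where "Du = (\<lambda>(x'::vec, t'::real) i. 1 * penalty_grad N \<epsilon> \<beta> y a x' i)"
  define Dv where "Dv = (\<lambda>(y'::vec, s'::real) i. (-1) * penalty_grad N \<epsilon> \<beta> x b y' i)"
  have Du: "Du (x, t) = pu"
    by (simp add: Du_def pu)
  have Dv: "Dv (y, s) = pv"
    by (simp add: Dv_def pv fun_eq_iff)
  have xt: "(x, t) \<in> QT N T" and ys: "(y, s) \<in> QT N T"
    using x y t s by (auto simp: QT_def)
  have "(\<lambda>(x'::vec, t'). 2 * (1 / \<epsilon>) * (t' - s) + \<eta>) (x, t) + F x (Du (x, t))
      (I_near N \<sigma> K \<delta> \<phi>u (Du (x, t)) x t + I_far N \<sigma> K \<delta> u (Du (x, t)) x t) \<le> 0"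
  proof -
    have "C2_QT N T \<phi>u Du (\<lambda>(x', t'). 2 * (1 / \<epsilon>) * (t' - s) + \<eta>)"
      unfolding \<phi>u Du_def by (rule C2_QT_penalty)
    moreover have "\<forall>q\<in>test_nbhd N T x t \<delta>. u q - \<phi>u q \<le> u (x, t) - \<phi>u (x, t)"
    proof
      fix q assume "q \<in> test_nbhd N T x t \<delta>"
      then obtain x' t' where q: "q = (x', t')" "x' \<in> RN N" "t' \<in> {0..T}"
        by (cases q) (auto simp: test_nbhd_def QT_def)
      then show "u q - \<phi>u q \<le> u (x, t) - \<phi>u (x, t)"
        using max[OF q(2) y q(3), of s] s by (simp add: eq)
    qed
    moreover have "\<delta> \<in> {0<..<1}"
      using \<delta> by simp
    ultimately show ?thesis
      using u xt unfolding viscosity_subsolution_def by blast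
  qed
  moreover have "(\<lambda>(y'::vec, s'). 2 * (- 1 / \<epsilon>) * (s' - t) + 0) (y, s) + F y (Dv (y, s))
      (I_near N \<sigma> K \<delta> \<phi>v (Dv (y, s)) y s + I_far N \<sigma> K \<delta> v (Dv (y, s)) y s) \<ge> 0"
  proof -
    have "C2_QT N T \<phi>v Dv (\<lambda>(y', s'). 2 * (- 1 / \<epsilon>) * (s' - t) + 0)"
      unfolding \<phi>v Dv_def by (rule C2_QT_penalty)
    moreover have "\<forall>q\<in>test_nbhd N T y s \<delta>. v (y, s) - \<phi>v (y, s) \<le> v q - \<phi>v q"
    proof
      fix q assume "q \<in> test_nbhd N T y s \<delta>"
      then obtain y' s' where q: "q = (y', s')" "y' \<in> RN N" "s' \<in> {0..T}"
        by (cases q) (auto simp: test_nbhd_def QT_def)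
      then show "v (y, s) - \<phi>v (y, s) \<le> v q - \<phi>v q"
        using max[OF x q(2) _ q(3), of t] t by (simp add: eq')
    qed
    moreover have "\<delta> \<in> {0<..<1}"
      using \<delta> by simp
    ultimately show ?thesis
      using v ys unfolding viscosity_supersolution_def by blast
  qed
  ultimately show ?thesis
    unfolding Du Dv by (simp add: algebra_simps diff_divide_distrib)
qed

section \<open>Rates in \<epsilon>\<close>

text \<open>The competitor moves x onto y when u is the regular function, or y onto x when v is.
  This removes the spatial penalty at the cost of one increment of that function, while the other
  function keeps its value and the bumps change by at most N \<beta>.\<close>

lemma doubled_max_distance:
  assumes x: "x \<in> RN N" and y: "y \<in> RN N" and t: "t \<in> {0..T}" and s: "s \<in> {0..T}"
    and \<beta>: "0 \<le> \<beta>"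
    and max: "\<And>x' t' y' s'. \<lbrakk>x' \<in> RN N; y' \<in> RN N; t' \<in> {0..T}; s' \<in> {0..T}\<rbrakk> \<Longrightarrow>
      doubled N u v \<epsilon> \<eta> \<beta> a b x' t' y' s' \<le> doubled N u v \<epsilon> \<eta> \<beta> a b x t y s"
    and w: "\<bar>u (x, t) - u (y, t)\<bar> \<le> B \<or> \<bar>v (x, s) - v (y, s)\<bar> \<le> B"
  shows "(norm_RN N (x - y))\<^sup>2 / \<epsilon> \<le> B + real N * \<beta>"
proof -
  have bumps: "\<beta> * bump N c z \<le> real N * \<beta>" "0 \<le> \<beta> * bump N c z" for c z
    using \<beta> bump_bounds[of N c z] by (simp_all add: mult.commute mult_left_mono)
  from w show ?thesis
  proof
    assume "\<bar>u (x, t) - u (y, t)\<bar> \<le> B"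
    moreover have "doubled N u v \<epsilon> \<eta> \<beta> a b y t y s \<le> doubled N u v \<epsilon> \<eta> \<beta> a b x t y s"
      by (rule max) fact+
    ultimately show ?thesis
      using bumps[of a x] bumps[of a y] by (simp add: doubled_def distrib_left)
  next
    assume "\<bar>v (x, s) - v (y, s)\<bar> \<le> B"
    moreover have "doubled N u v \<epsilon> \<eta> \<beta> a b x t x s \<le> doubled N u v \<epsilon> \<eta> \<beta> a b x t y s"
      by (rule max) fact+
    ultimately show ?thesis
      using bumps[of b x] bumps[of b y] by (simp add: doubled_def distrib_left)
  qed
qed

text \<open>Without the error c \<beta> one would get r = O(\<epsilon>^(1 / (2 - \<alpha>))). The
  weaker exponent \<alpha> suffices here and lets the error be absorbed.\<close>

lemma distance_rate:
  fixes r \<epsilon> H c \<alpha> \<beta> :: real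
  assumes r: "r\<^sup>2 / \<epsilon> \<le> H * r powr \<alpha> + c * \<beta>" "0 \<le> r"
    and \<epsilon>: "0 < \<epsilon>" "\<epsilon> \<le> 1" and \<alpha>: "0 < \<alpha>" "\<alpha> < 1" and "0 \<le> H" "0 \<le> c" "\<beta> \<le> \<epsilon>"
  shows "r \<le> (H + c + 1) * \<epsilon> powr \<alpha>"
proof (rule ccontr)
  define C where "C = H + c + 1"
  have C: "1 \<le> C"
    using assms by (simp add: C_def)
  assume "\<not> r \<le> (H + c + 1) * \<epsilon> powr \<alpha>"
  then have gt: "C * \<epsilon> powr \<alpha> < r"
    by (simp add: C_def)
  have r\<epsilon>: "\<epsilon> powr \<alpha> \<le> r"
    using gt mult_right_mono[OF C, of "\<epsilon> powr \<alpha>"] by simp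
  have r0: "0 < r"
    by (rule less_le_trans[OF _ r\<epsilon>]) (use \<epsilon> in simp)
  \<comment> \<open>If r exceeds \<epsilon>^\<alpha>, then \<beta> \<le> \<epsilon> \<le>
    \<epsilon>^(\<alpha> * \<alpha>) \<le> r^\<alpha>, and the error joins the Hoelder term.\<close>
  have "\<epsilon> = \<epsilon> powr 1"
    using \<epsilon> by simp
  also have "\<dots> \<le> \<epsilon> powr (\<alpha> * \<alpha>)"
    using \<epsilon> \<alpha> by (intro powr_mono') (auto simp: mult_le_one)
  also have "\<dots> = (\<epsilon> powr \<alpha>) powr \<alpha>"
    by (simp add: powr_powr)
  also have "\<dots> \<le> r powr \<alpha>"
    using r\<epsilon> \<alpha> by (intro powr_mono2) auto
  finally have "c * \<beta> \<le> c * r powr \<alpha>"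
    using assms by (intro mult_left_mono) auto
  then have "r\<^sup>2 / \<epsilon> \<le> (H + c) * r powr \<alpha>"
    using r by (simp add: distrib_right)
  then have "r\<^sup>2 \<le> \<epsilon> * (H + c) * r powr \<alpha>"
    using \<epsilon> by (simp add: field_simps)
  moreover have "r\<^sup>2 = r powr (2 - \<alpha>) * r powr \<alpha>"
    using r0 by (simp add: powr_add[symmetric])
  ultimately have "r powr (2 - \<alpha>) \<le> \<epsilon> * (H + c)"
    using r0 by simp
  also have "\<dots> < \<epsilon> * C"
    using \<epsilon> by (simp add: C_def)
  also have "\<dots> \<le> \<epsilon> powr (\<alpha> * (2 - \<alpha>)) * C powr (2 - \<alpha>)"
  proof (intro mult_mono)
    \<comment> \<open>This square yields \<alpha> (2 - \<alpha>) \<le> 1, that is, \<alpha> \<le> 1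
      / (2 - \<alpha>).\<close>
    have "0 \<le> (1 - \<alpha>)\<^sup>2"
      by simp
    then have "\<alpha> * (2 - \<alpha>) \<le> 1"
      by (simp add: power2_eq_square algebra_simps)
    then have "\<epsilon> powr 1 \<le> \<epsilon> powr (\<alpha> * (2 - \<alpha>))"
      using \<epsilon> by (intro powr_mono') auto
    then show "\<epsilon> \<le> \<epsilon> powr (\<alpha> * (2 - \<alpha>))"
      using \<epsilon> by simp
    have "C powr 1 \<le> C powr (2 - \<alpha>)"
      using C \<alpha> by (intro powr_mono) auto
    then show "C \<le> C powr (2 - \<alpha>)"
      using C by simp
  qed (use C in auto)
  also have "\<dots> = (C * \<epsilon> powr \<alpha>) powr (2 - \<alpha>)"
    using C by (simp add: powr_mult powr_powr)
  also have "\<dots> \<le> r powr (2 - \<alpha>)"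
    using gt C \<alpha> by (intro powr_mono2) auto
  finally show False
    by simp
qed

text \<open>W dominates 1, L and P^m up to constants, and by \<open>small\<close> its n-th power
  costs at most \<epsilon>^(-1/4). The distance then contributes \<epsilon>^(3/4 - \<kappa>), which
  \<kappa> \<le> 1/2 turns into \<epsilon>^(1/4); the other terms start from \<epsilon> and have
  room to spare.\<close>

lemma structure_argument_rate:
  fixes \<epsilon> \<kappa> A m n :: real
  assumes \<epsilon>: "0 < \<epsilon>" "\<epsilon> \<le> 1" and \<kappa>: "0 < \<kappa>" "\<kappa> \<le> 1 / 2" and A: "0 < A" and m: "1 < m" and n: "0 < n"
    and small: "(A + 1 + m) * \<kappa> * n \<le> 1 / 4"
    and r: "0 \<le> r" "r \<le> C1 * \<epsilon> powr (1 - \<kappa>)" and P: "0 \<le> P" "P \<le> C2 * \<epsilon> powr (- \<kappa>)"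
    and L: "0 \<le> L" "L \<le> C3 * \<epsilon> powr (- ((A + 1) * \<kappa>))" and e: "e \<le> C4 * \<epsilon>"
    and d: "0 \<le> d" "d \<le> C5 * \<epsilon>" and C: "0 \<le> C1" "0 \<le> C2" "0 \<le> C3" "0 \<le> C4" "0 \<le> C5"
  shows "e + r * (1 + L + P powr m) powr n + d * (1 + L + P powr m) powr n
    \<le> (C4 + (C1 + C5) * (1 + C3 + C2 powr m) powr n) * \<epsilon> powr (1 / 4)"
proof -
  have mono: "\<epsilon> powr b \<le> \<epsilon> powr b'" if "b' \<le> b" for b b'
    using that \<epsilon> by (intro powr_mono') auto
  define W where "W = \<epsilon> powr (- ((A + 1 + m) * \<kappa>))"
  define D where "D = 1 + C3 + C2 powr m"
  have D: "0 \<le> D"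
    using C by (simp add: D_def)
  have "\<epsilon> powr 0 \<le> W"
    unfolding W_def using A m \<kappa> by (intro mono) auto
  then have W1: "1 \<le> W"
    using \<epsilon> by simp
  have "\<epsilon> powr (- ((A + 1) * \<kappa>)) \<le> W"
    unfolding W_def using m \<kappa> by (intro mono) (auto simp: mult_right_mono)
  then have LW: "L \<le> C3 * W"
    using L C(3) by (meson mult_left_mono order_trans)
  have "P powr m \<le> (C2 * \<epsilon> powr (- \<kappa>)) powr m"
    using P m by (intro powr_mono2) auto
  also have "\<dots> = C2 powr m * \<epsilon> powr (- (m * \<kappa>))"
    using C by (simp add: powr_mult powr_powr mult.commute)
  also have "\<dots> \<le> C2 powr m * W"
    unfolding W_def using A \<kappa> by (intro mult_left_mono mono) (auto simp: mult_right_mono)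
  finally have PW: "P powr m \<le> C2 powr m * W" .
  have "1 + L + P powr m \<le> D * W"
    using W1 LW PW by (simp add: D_def distrib_right)
  then have "(1 + L + P powr m) powr n \<le> (D * W) powr n"
    using n L by (intro powr_mono2) auto
  also have "\<dots> = D powr n * \<epsilon> powr (- ((A + 1 + m) * \<kappa> * n))"
    using D by (simp add: W_def powr_mult powr_powr)
  also have "\<dots> \<le> D powr n * \<epsilon> powr (- (1 / 4))"
    using small by (intro mult_left_mono mono) auto
  finally have Wn: "(1 + L + P powr m) powr n \<le> D powr n * \<epsilon> powr (- (1 / 4))" .
  have "r * (1 + L + P powr m) powr n
      \<le> (C1 * \<epsilon> powr (1 - \<kappa>)) * (D powr n * \<epsilon> powr (- (1 / 4)))"
    by (intro mult_mono r Wn) (use C in auto)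
  also have "\<dots> = C1 * D powr n * \<epsilon> powr (3 / 4 - \<kappa>)"
    using \<epsilon> by (simp add: powr_add[symmetric])
  also have "\<dots> \<le> C1 * D powr n * \<epsilon> powr (1 / 4)"
    using \<kappa> C by (intro mult_left_mono mono) auto
  finally have 1: "r * (1 + L + P powr m) powr n \<le> C1 * D powr n * \<epsilon> powr (1 / 4)" .
  have "d * (1 + L + P powr m) powr n \<le> (C5 * \<epsilon> powr 1) * (D powr n * \<epsilon> powr (- (1 / 4)))"
    by (intro mult_mono Wn) (use C d \<epsilon> in auto)
  also have "\<dots> = C5 * D powr n * \<epsilon> powr (3 / 4)"
    using \<epsilon> powr_add[of \<epsilon> 1 "- (1 / 4)"] by simp
  also have "\<dots> \<le> C5 * D powr n * \<epsilon> powr (1 / 4)"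
    using C by (intro mult_left_mono mono) auto
  finally have 2: "d * (1 + L + P powr m) powr n \<le> C5 * D powr n * \<epsilon> powr (1 / 4)" .
  have "e \<le> C4 * \<epsilon> powr 1"
    using e \<epsilon> by simp
  also have "\<dots> \<le> C4 * \<epsilon> powr (1 / 4)"
    using C by (intro mult_left_mono mono) auto
  finally have "e \<le> C4 * \<epsilon> powr (1 / 4)" .
  with 1 2 show ?thesis
    by (simp add: D_def algebra_simps)
qed

text \<open>The far moment is finite only for exponents below \<sigma>, whereas \<alpha> may exceed
  \<sigma>. Boundedness handles r > 1, so the exponent can be lowered without restricting r.\<close>

lemma Holder_lower_exponent:
  fixes r :: real
  assumes "\<bar>d\<bar> \<le> H * r powr \<alpha>" "\<bar>d\<bar> \<le> 2 * M" "0 \<le> r" "0 \<le> q" "q \<le> \<alpha>" "0 \<le> H" "0 \<le> M"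
  shows "\<bar>d\<bar> \<le> (H + 2 * M) * r powr q"
proof (cases "r \<le> 1")
  case True
  have "\<bar>d\<bar> \<le> H * r powr \<alpha>"
    by fact
  also have "\<dots> \<le> H * r powr q"
    using assms True by (intro mult_left_mono powr_mono') auto
  also have "\<dots> \<le> (H + 2 * M) * r powr q"
    using assms by (intro mult_right_mono) auto
  finally show ?thesis .
next
  case False
  have "\<bar>d\<bar> \<le> 2 * M * 1"
    using assms by simp
  also have "\<dots> \<le> (H + 2 * M) * r powr q"
    using assms False by (intro mult_mono) (auto simp: ge_one_powr_ge_zero)
  finally show ?thesis .
qed

text \<open>The constant C depends on neither \<epsilon> and \<eta> nor the centres and the maximum
  point, so that \<epsilon> may tend to 0 afterwards with \<eta> fixed.\<close>

lemma comparison_estimate: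
  fixes \<kappa> A m n \<sigma> \<alpha> H M :: real and N :: nat
  assumes \<sigma>: "0 < \<sigma>" "\<sigma> \<le> 1" and n: "0 < n" and m: "1 < m"
    and A: "A = 2 / (1 + I_ind \<sigma> - \<sigma>)"
    and \<kappa>: "0 < \<kappa>" "\<kappa> < \<sigma>" "\<kappa> \<le> 1 / 2" "(A + 1 + m) * \<kappa> * n \<le> 1 / 4"
    and \<alpha>: "1 - \<kappa> < \<alpha>" "\<alpha> < 1"
    and K: "admissible_kernel N \<sigma> K" and F: "degenerate_elliptic N F"
    and \<omega>: "modulus_of_continuity \<omega>" and str: "structure_condition N n m \<omega> F"
    and u: "usc_on (QT_bar N T) u" "viscosity_subsolution N \<sigma> K F T u"
    and v: "lsc_on (QT_bar N T) v" "viscosity_supersolution N \<sigma> K F T v"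
    and uM: "\<And>q. q \<in> QT_bar N T \<Longrightarrow> \<bar>u q\<bar> \<le> M" and vM: "\<And>q. q \<in> QT_bar N T \<Longrightarrow> \<bar>v q\<bar> \<le> M"
    and H: "0 \<le> H"
    and w: "w = u \<or> w = v"
    and Hw: "\<And>x y t. \<lbrakk>x \<in> RN N; y \<in> RN N; t \<in> {0..T}\<rbrakk> \<Longrightarrow>
      \<bar>w (x, t) - w (y, t)\<bar> \<le> H * norm_RN N (x - y) powr \<alpha>"
  obtains C where "0 \<le> C" and "\<And>\<epsilon> \<eta> a b x t y s.
    \<lbrakk>0 < \<epsilon>; \<epsilon> < 1; x \<in> RN N; y \<in> RN N; t \<in> {0<..T}; s \<in> {0<..T};
      \<And>x' t' y' s'. \<lbrakk>x' \<in> RN N; y' \<in> RN N; t' \<in> {0..T}; s' \<in> {0..T}\<rbrakk> \<Longrightarrow>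
        doubled N u v \<epsilon> \<eta> (\<epsilon> powr (A + 2)) a b x' t' y' s'
          \<le> doubled N u v \<epsilon> \<eta> (\<epsilon> powr (A + 2)) a b x t y s\<rbrakk>
    \<Longrightarrow> \<eta> \<le> \<omega> (C * \<epsilon> powr (1 / 4))"
proof -
  have den: "0 < 1 + I_ind \<sigma> - \<sigma>" "1 + I_ind \<sigma> - \<sigma> \<le> 1"
    using \<sigma> by (auto simp: I_ind_def)
  have A0: "0 < A"
    using den by (simp add: A)
  have A_den: "A * (1 + I_ind \<sigma> - \<sigma>) = 2"
    using den A by (metis less_irrefl nonzero_eq_divide_eq)
  obtain Cn where Cn: "0 \<le> Cn" and near:
    "\<And>(\<delta>::real) A P \<phi> p x t. \<lbrakk>0 < \<delta>; \<delta> < 1; 0 \<le> A; norm_RN N p \<le> P;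
      \<And>z. z \<in> RN N \<Longrightarrow> \<bar>\<phi> (x + z, t) - \<phi> (x, t) - inner_RN N p z\<bar> \<le> A * (norm_RN N z)\<^sup>2\<rbrakk>
      \<Longrightarrow> \<bar>I_near N \<sigma> K \<delta> \<phi> p x t\<bar> \<le> (A + P) * (Cn * \<delta> powr (1 + I_ind \<sigma> - \<sigma>))"
    using I_near_bound[OF K \<sigma>(2)] by blast
  define q where "q = \<sigma> - \<kappa>"
  have q: "0 \<le> q" "q < \<sigma>" "q \<le> \<alpha>"
    using \<kappa> \<alpha> \<sigma> by (auto simp: q_def)
  obtain Cf where Cf: "0 \<le> Cf" and far:
    "\<And>(\<delta>::real) H P w p x t. \<lbrakk>0 < \<delta>; 0 \<le> H; norm_RN N p \<le> P;
      \<And>z. z \<in> RN N \<Longrightarrow> \<bar>w (x + z, t) - w (x, t)\<bar> \<le> H * norm_RN N z powr q\<rbrakk>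
      \<Longrightarrow> \<bar>I_far N \<sigma> K \<delta> w p x t\<bar> \<le> (H + P) * (Cf * \<delta> powr (q - \<sigma>))"
    using I_far_bound[OF K q(1,2) \<sigma>(2)] by blast
  obtain Cc where Cc: "0 \<le> Cc" and compare:
    "\<And>T u v M (\<delta>::real) e p p' x t y s. \<lbrakk>usc_on (QT_bar N T) u; lsc_on (QT_bar N T) v;
      \<And>q. q \<in> QT_bar N T \<Longrightarrow> \<bar>u q\<bar> \<le> M; \<And>q. q \<in> QT_bar N T \<Longrightarrow> \<bar>v q\<bar> \<le> M;
      x \<in> RN N; y \<in> RN N; t \<in> {0..T}; s \<in> {0..T}; 0 < \<delta>; norm_RN N (p - p') \<le> e;
      \<And>z. z \<in> RN N \<Longrightarrow> u (x + z, t) - u (x, t) - (v (y + z, s) - v (y, s)) \<le> e\<rbrakk>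
      \<Longrightarrow> I_far N \<sigma> K \<delta> u p x t - I_far N \<sigma> K \<delta> v p' y s \<le> 2 * e * (Cc * \<delta> powr (- \<sigma>))"
    using I_far_compare[OF K \<sigma>(1)] by blast
  \<comment> \<open>Meaning of the constants: C1 for |x - y|, C2 for the gradients, C3 for the inner
    parts, C4 for the outer part of the Hoelder function, C6 for the error in ordering the nonlocal
    terms, C7 for the size of the values inserted into F.\<close>
  define C1 where "C1 = H + real N + 1"
  define C2 where "C2 = 2 * C1 + real N"
  define C3 where "C3 = (4 + C2) * Cn"
  define C4 where "C4 = (H + 2 * \<bar>M\<bar> + C2) * Cf"
  define C6 where "C6 = 2 * C3 + 4 * real N * Cc"
  define C7 where "C7 = C3 + C4 + C6"
  define C where "C = C6 + (C1 + 2 * real N) * (1 + C7 + C2 powr m) powr n"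
  have nonneg: "0 \<le> C1" "0 \<le> C2" "0 \<le> C3" "0 \<le> C4" "0 \<le> C6" "0 \<le> C7" "0 \<le> C"
    using H Cn Cf Cc by (simp_all add: C1_def C2_def C3_def C4_def C6_def C7_def C_def)
  show thesis
  proof (rule that[OF nonneg(7)])
    fix \<epsilon> \<eta> t s :: real and a b x y :: vec
    assume \<epsilon>: "0 < \<epsilon>" "\<epsilon> < 1" and x: "x \<in> RN N" and y: "y \<in> RN N"
      and t: "t \<in> {0<..T}" and s: "s \<in> {0<..T}"
    define \<beta> where "\<beta> = \<epsilon> powr (A + 2)"
    assume "\<And>x' t' y' s'. \<lbrakk>x' \<in> RN N; y' \<in> RN N; t' \<in> {0..T}; s' \<in> {0..T}\<rbrakk> \<Longrightarrow>
        doubled N u v \<epsilon> \<eta> (\<epsilon> powr (A + 2)) a b x' t' y' s'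
          \<le> doubled N u v \<epsilon> \<eta> (\<epsilon> powr (A + 2)) a b x t y s"
    note max = this[folded \<beta>_def]
    have t': "t \<in> {0..T}" and s': "s \<in> {0..T}"
      using t s by auto
    have mono: "\<epsilon> powr b \<le> \<epsilon> powr b'" if "b' \<le> b" for b b'
      using that \<epsilon> by (intro powr_mono') auto
    \<comment> \<open>The size of the Hoelder function's nonlocal term: \<epsilon>^(-\<kappa>) from
      the gradient times \<delta>^(q - \<sigma>) = \<epsilon>^(-A \<kappa>).\<close>
    define E where "E = \<epsilon> powr (- ((A + 1) * \<kappa>))"
    have "\<epsilon> powr 0 \<le> E"
      unfolding E_def using A0 \<kappa> by (intro mono) simp
    then have E1: "1 \<le> E"
      using \<epsilon> by simp
    have \<epsilon>E: "\<epsilon> \<le> E"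
      using E1 \<epsilon> by simp
    have "\<beta> \<le> \<epsilon> powr 1"
      unfolding \<beta>_def using A0 by (intro mono) simp
    then have \<beta>: "0 < \<beta>" "\<beta> \<le> \<epsilon>" "\<beta> \<le> 1"
      using \<epsilon> by (auto simp: \<beta>_def)
    define \<delta> where "\<delta> = \<epsilon> powr A"
    have "\<delta> < \<epsilon> powr 0"
      unfolding \<delta>_def using A0 \<epsilon> by (intro powr_less_mono') auto
    then have \<delta>: "0 < \<delta>" "\<delta> < 1"
      using \<epsilon> by (auto simp: \<delta>_def)
    define r where "r = norm_RN N (x - y)"
    have r0: "0 \<le> r"
      by (simp add: r_def)
    have "r\<^sup>2 / \<epsilon> \<le> H * r powr \<alpha> + real N * \<beta>"
      unfolding r_def
      by (rule doubled_max_distance[OF x y t' s' _ max]) (use \<beta> w Hw x y t' s' in auto)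
    then have "r \<le> C1 * \<epsilon> powr \<alpha>"
      unfolding C1_def using r0 \<epsilon> \<alpha> \<kappa> H \<beta> by (intro distance_rate) auto
    also have "\<dots> \<le> C1 * \<epsilon> powr (1 - \<kappa>)"
      using \<alpha> nonneg by (intro mult_left_mono mono) auto
    finally have r: "r \<le> C1 * \<epsilon> powr (1 - \<kappa>)" .
    define pu where "pu = penalty_grad N \<epsilon> \<beta> y a x"
    define pv where "pv = - penalty_grad N \<epsilon> \<beta> x b y"
    have pRN: "pu \<in> RN N" "pv \<in> RN N"
      unfolding pu_def pv_def by (intro penalty_grad_in_RN RN_closed_minus)+
    define P where "P = C2 * \<epsilon> powr (- \<kappa>)"
    have rP: "2 * r / \<epsilon> + real N \<le> P"
    proof -
      have "2 * r / \<epsilon> \<le> 2 * (C1 * \<epsilon> powr (1 - \<kappa>)) / \<epsilon>"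
        using r \<epsilon> by (intro divide_right_mono) auto
      also have "\<dots> = 2 * C1 * \<epsilon> powr (- \<kappa>)"
        using \<epsilon> by (simp add: powr_diff powr_minus divide_inverse)
      finally have "2 * r / \<epsilon> \<le> 2 * C1 * \<epsilon> powr (- \<kappa>)" .
      moreover have "\<epsilon> powr 0 \<le> \<epsilon> powr (- \<kappa>)"
        using \<kappa> by (intro mono) auto
      then have "real N * 1 \<le> real N * \<epsilon> powr (- \<kappa>)"
        using \<epsilon> by (intro mult_left_mono) auto
      ultimately show ?thesis
        by (simp add: P_def C2_def distrib_right)
    qed
    have puP: "norm_RN N pu \<le> P"
      using penalty_grad_norm_le[of \<epsilon> \<beta> N y a x] \<epsilon> \<beta> rP by (simp add: pu_def r_def)
    have pvP: "norm_RN N pv \<le> P"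
      using penalty_grad_norm_le[of \<epsilon> \<beta> N x b y] \<epsilon> \<beta> rP
      by (simp add: pv_def r_def norm_RN_minus_commute[of N x y])
    have pd: "norm_RN N (pu - pv) \<le> 2 * real N * \<beta>"
      unfolding pu_def pv_def using \<beta> by (intro penalty_grad_opposite) auto
    have P\<epsilon>: "P \<le> C2 / \<epsilon>"
    proof -
      have "P \<le> C2 * \<epsilon> powr (- 1)"
        unfolding P_def using \<kappa> nonneg by (intro mult_left_mono mono) auto
      then show ?thesis
        using \<epsilon> by (simp add: powr_minus divide_inverse)
    qed
    define \<phi>u where "\<phi>u = (\<lambda>(x', t'). 1 * penalty N \<epsilon> \<beta> y a x' + (1 / \<epsilon> * (t' - s)\<^sup>2 + \<eta> * t'))"
    define \<phi>v where
      "\<phi>v = (\<lambda>(y', s'). (-1) * penalty N \<epsilon> \<beta> x b y' + (- 1 / \<epsilon> * (s' - t)\<^sup>2 + 0 * s'))"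
    define nu where "nu = I_near N \<sigma> K \<delta> \<phi>u pu x t"
    define nv where "nv = I_near N \<sigma> K \<delta> \<phi>v pv y s"
    define fu where "fu = I_far N \<sigma> K \<delta> u pu x t"
    define fv where "fv = I_far N \<sigma> K \<delta> v pv y s"
    have visc: "\<eta> \<le> F y pv (nv + fv) - F x pu (nu + fu)"
      unfolding nu_def nv_def fu_def fv_def
      by (rule viscosity_doubling[OF u(2) v(2) x y t s \<delta> max pu_def pv_def \<phi>u_def \<phi>v_def])
    \<comment> \<open>The choice of A makes the power of \<delta> equal to \<epsilon>^2, which pays
      for the factor 1/\<epsilon> in the Hessian and in P and leaves one \<epsilon>.\<close>
    have near_rate: "(4 / \<epsilon> + P) * (Cn * \<delta> powr (1 + I_ind \<sigma> - \<sigma>)) \<le> C3 * \<epsilon>"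
    proof -
      have "\<delta> powr (1 + I_ind \<sigma> - \<sigma>) = \<epsilon> powr 2"
        unfolding \<delta>_def powr_powr A_den ..
      then have "\<delta> powr (1 + I_ind \<sigma> - \<sigma>) = \<epsilon> * \<epsilon>"
        using \<epsilon> by (simp add: power2_eq_square)
      moreover have "(4 / \<epsilon> + P) * (Cn * (\<epsilon> * \<epsilon>)) \<le> ((4 + C2) / \<epsilon>) * (Cn * (\<epsilon> * \<epsilon>))"
        using P\<epsilon> Cn \<epsilon> by (intro mult_right_mono) (auto simp: add_divide_distrib)
      ultimately show ?thesis
        using \<epsilon> by (simp add: C3_def mult_ac)
    qed
    have nu: "\<bar>nu\<bar> \<le> C3 * \<epsilon>"
    proof -
      have "\<bar>nu\<bar> \<le> (4 / \<epsilon> + P) * (Cn * \<delta> powr (1 + I_ind \<sigma> - \<sigma>))"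
        unfolding nu_def
      proof (rule near[OF \<delta> _ puP])
        fix z
        show "\<bar>\<phi>u (x + z, t) - \<phi>u (x, t) - inner_RN N pu z\<bar> \<le> 4 / \<epsilon> * (norm_RN N z)\<^sup>2"
          using penalty_taylor[of \<epsilon> \<beta> N y a x z] \<epsilon> \<beta> by (simp add: \<phi>u_def pu_def)
      qed (use \<epsilon> in simp)
      with near_rate show ?thesis
        by linarith
    qed
    have nv: "\<bar>nv\<bar> \<le> C3 * \<epsilon>"
    proof -
      have "\<bar>nv\<bar> \<le> (4 / \<epsilon> + P) * (Cn * \<delta> powr (1 + I_ind \<sigma> - \<sigma>))"
        unfolding nv_def
      proof (rule near[OF \<delta> _ pvP])
        fix z
        have "inner_RN N pv z = - inner_RN N (penalty_grad N \<epsilon> \<beta> x b y) z"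
          by (simp add: inner_RN_def pv_def sum_negf)
        then have "\<bar>\<phi>v (y + z, s) - \<phi>v (y, s) - inner_RN N pv z\<bar>
            = \<bar>penalty N \<epsilon> \<beta> x b (y + z) - penalty N \<epsilon> \<beta> x b y
              - inner_RN N (penalty_grad N \<epsilon> \<beta> x b y) z\<bar>"
          by (simp add: \<phi>v_def)
        also have "\<dots> \<le> 4 / \<epsilon> * (norm_RN N z)\<^sup>2"
          using \<epsilon> \<beta> by (intro penalty_taylor) auto
        finally show "\<bar>\<phi>v (y + z, s) - \<phi>v (y, s) - inner_RN N pv z\<bar> \<le> 4 / \<epsilon> * (norm_RN N z)\<^sup>2" .
      qed (use \<epsilon> in simp)
      with near_rate show ?thesis
        by linarith
    qed
    have far_w: "\<bar>I_far N \<sigma> K \<delta> w p x' t0\<bar> \<le> C4 * E"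
      if p: "norm_RN N p \<le> P" and x': "x' \<in> RN N" and t0: "t0 \<in> {0..T}" for p x' t0
    proof -
      have "\<bar>I_far N \<sigma> K \<delta> w p x' t0\<bar> \<le> (H + 2 * \<bar>M\<bar> + P) * (Cf * \<delta> powr (q - \<sigma>))"
      proof (rule far[OF \<delta>(1) _ p])
        fix z assume z: "z \<in> RN N"
        show "\<bar>w (x' + z, t0) - w (x', t0)\<bar> \<le> (H + 2 * \<bar>M\<bar>) * norm_RN N z powr q"
        proof (rule Holder_lower_exponent)
          show "\<bar>w (x' + z, t0) - w (x', t0)\<bar> \<le> H * norm_RN N z powr \<alpha>"
            using Hw[OF RN_closed_add[OF x' z] x' t0] by simp
          have "\<bar>w (x' + z, t0)\<bar> \<le> M" "\<bar>w (x', t0)\<bar> \<le> M"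
            using w uM vM x' z t0 by (auto simp: QT_bar_def RN_closed_add)
          then show "\<bar>w (x' + z, t0) - w (x', t0)\<bar> \<le> 2 * \<bar>M\<bar>"
            by linarith
        qed (use q H in auto)
      qed (use H in auto)
      also have "\<dots> \<le> ((H + 2 * \<bar>M\<bar> + C2) * \<epsilon> powr (- \<kappa>)) * (Cf * \<delta> powr (q - \<sigma>))"
      proof (intro mult_right_mono)
        have "\<epsilon> powr 0 \<le> \<epsilon> powr (- \<kappa>)"
          using \<kappa> by (intro mono) auto
        then have "(H + 2 * \<bar>M\<bar>) * 1 \<le> (H + 2 * \<bar>M\<bar>) * \<epsilon> powr (- \<kappa>)"
          using \<epsilon> H by (intro mult_left_mono) auto
        then show "H + 2 * \<bar>M\<bar> + P \<le> (H + 2 * \<bar>M\<bar> + C2) * \<epsilon> powr (- \<kappa>)"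
          by (simp add: P_def distrib_right)
      qed (use Cf in auto)
      also have "\<dots> = C4 * (\<epsilon> powr (- \<kappa>) * \<epsilon> powr (A * (q - \<sigma>)))"
        by (simp add: C4_def \<delta>_def powr_powr mult_ac)
      also have "\<epsilon> powr (- \<kappa>) * \<epsilon> powr (A * (q - \<sigma>)) = E"
        unfolding E_def powr_add[symmetric] by (simp add: q_def algebra_simps)
      finally show ?thesis .
    qed
    define e where "e = C6 * \<epsilon>"
    have e0: "0 \<le> e"
      using nonneg \<epsilon> by (simp add: e_def)
    have "fu - fv \<le> 2 * (2 * real N * \<beta>) * (Cc * \<delta> powr (- \<sigma>))"
      unfolding fu_def fv_def
    proof (rule compare[OF u(1) v(1) uM vM x y t' s' \<delta>(1) pd])
      fix z assume z: "z \<in> RN N"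
      \<comment> \<open>Shifting both points by the same z preserves x - y, so maximality compares
        the increments of u and v up to the bumps alone.\<close>
      have "x + z - (y + z) = x - y"
        by simp
      moreover have "doubled N u v \<epsilon> \<eta> \<beta> a b (x + z) t (y + z) s \<le> doubled N u v \<epsilon> \<eta> \<beta> a b x t y s"
        using x y z t' s' by (intro max RN_closed_add)
      ultimately have "u (x + z, t) - u (x, t) - (v (y + z, s) - v (y, s))
          \<le> \<beta> * (bump N a (x + z) + bump N b (y + z)) - \<beta> * (bump N a x + bump N b y)"
        by (simp add: doubled_def)
      also have "\<dots> \<le> \<beta> * (real N + real N) - \<beta> * 0"
        using \<beta> bump_bounds by (intro diff_mono mult_left_mono add_mono) (auto intro: add_nonneg_nonneg)
      finally show "u (x + z, t) - u (x, t) - (v (y + z, s) - v (y, s)) \<le> 2 * real N * \<beta>"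
        by (simp add: algebra_simps)
    qed
    also have "\<dots> = 4 * real N * Cc * (\<beta> * \<delta> powr (- \<sigma>))"
      by simp
    also have "\<dots> \<le> 4 * real N * Cc * \<epsilon>"
    proof (rule mult_left_mono)
      \<comment> \<open>Here the exponent A + 2 of \<beta> pays off: A outweighs
        \<delta>^(-\<sigma>) = \<epsilon>^(-A \<sigma>), and the surplus 2 leaves at least one
        factor \<epsilon>.\<close>
      have "A * \<sigma> \<le> A * 1"
        using A0 \<sigma> by (intro mult_left_mono) auto
      then have "\<epsilon> powr (A + 2 + A * (- \<sigma>)) \<le> \<epsilon> powr 1"
        by (intro mono) simp
      then show "\<beta> * \<delta> powr (- \<sigma>) \<le> \<epsilon>"
        using \<epsilon> unfolding \<beta>_def \<delta>_def powr_powr powr_add[symmetric] by simp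
    qed (use Cc in simp)
    finally have "(nu + fu) - (nv + fv) \<le> e"
      using nu nv by (simp add: e_def C6_def algebra_simps abs_le_iff)
    then have luv: "nu + fu \<le> nv + fv + e"
      by simp
    have C3E: "C3 * \<epsilon> \<le> C3 * E" and eE: "e \<le> C6 * E"
      using \<epsilon>E nonneg by (auto simp: e_def intro!: mult_left_mono)
    \<comment> \<open>Only the nonlocal term of w has a bound. As F is nonincreasing in l and
      \<open>luv\<close> orders the two terms up to e, the other term is replaced by that of w,
      shifted by e in the direction that preserves the inequality.\<close>
    obtain l1 l2 where l: "\<eta> \<le> F y pv l2 - F x pu l1" "\<bar>l2 - l1\<bar> \<le> e"
      "\<bar>l1\<bar> \<le> C7 * E" "\<bar>l2\<bar> \<le> C7 * E"
    proof (cases "w = u")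
      case True
      have "F y pv (nv + fv) \<le> F y pv (nu + fu - e)"
        using F y pRN luv by (simp add: degenerate_elliptic_def)
      moreover have "\<bar>nu + fu\<bar> \<le> C3 * E + C4 * E"
        using nu C3E far_w[OF puP x t'] True by (simp add: fu_def)
      moreover have "0 \<le> C6 * E"
        using eE e0 by linarith
      ultimately show thesis
        using visc eE e0 by (intro that[of "nu + fu - e" "nu + fu"])
          (auto simp: C7_def distrib_right)
    next
      case False
      have "F x pu (nv + fv + e) \<le> F x pu (nu + fu)"
        using F x pRN luv by (simp add: degenerate_elliptic_def)
      moreover have "\<bar>nv + fv\<bar> \<le> C3 * E + C4 * E"
        using nv C3E far_w[OF pvP y s'] False w by (simp add: fv_def)
      moreover have "0 \<le> C6 * E"
        using eE e0 by linarith
      ultimately show thesis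
        using visc eE e0 by (intro that[of "nv + fv" "nv + fv + e"])
          (auto simp: C7_def distrib_right)
    qed
    define P' where "P' = max (norm_RN N pv) (norm_RN N pu)"
    define L where "L = max \<bar>l2\<bar> \<bar>l1\<bar>"
    define X where "X = \<bar>l2 - l1\<bar> + norm_RN N (y - x) * (1 + L + P' powr m) powr n
        + norm_RN N (pv - pu) * (1 + L + P' powr m) powr n"
    have "X \<le> C * \<epsilon> powr (1 / 4)"
      unfolding X_def C_def
    proof (rule structure_argument_rate[where \<kappa> = \<kappa> and A = A])
      show "norm_RN N (y - x) \<le> C1 * \<epsilon> powr (1 - \<kappa>)"
        using r by (simp add: r_def norm_RN_minus_commute)
      show "P' \<le> C2 * \<epsilon> powr (- \<kappa>)"
        using puP pvP by (simp add: P'_def P_def)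
      show "L \<le> C7 * \<epsilon> powr (- ((A + 1) * \<kappa>))"
        using l by (simp add: L_def E_def)
      show "\<bar>l2 - l1\<bar> \<le> C6 * \<epsilon>"
        using l by (simp add: e_def)
      show "norm_RN N (pv - pu) \<le> 2 * real N * \<epsilon>"
        using pd mult_left_mono[OF \<beta>(2), of "2 * real N"]
        by (simp add: norm_RN_minus_commute[of N pv pu])
    qed (use \<epsilon> \<kappa> A0 m n nonneg in \<open>auto simp: P'_def L_def le_max_iff_disj\<close>)
    moreover have "0 \<le> X"
      unfolding X_def by (intro add_nonneg_nonneg mult_nonneg_nonneg) simp_all
    moreover have "mono_on {0..} \<omega>"
      using \<omega> by (simp add: modulus_of_continuity_def)
    ultimately have "\<omega> X \<le> \<omega> (C * \<epsilon> powr (1 / 4))"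
      using nonneg(7) by (intro mono_onD[of "{0..}" \<omega>]) simp_all
    moreover have "\<bar>F y pv l2 - F x pu l1\<bar> \<le> \<omega> X"
      using str[unfolded structure_condition_def Let_def, rule_format, OF y x pRN(2) pRN(1), of l2 l1]
      by (simp only: X_def P'_def L_def)
    ultimately show "\<eta> \<le> \<omega> (C * \<epsilon> powr (1 / 4))"
      using l(1) by linarith
  qed
qed

section \<open>Comparison\<close>

lemma Holder_QT_barE:
  assumes "Holder_QT_bar N T \<alpha> f"
  obtains H where "0 \<le> H" and "\<And>x t y s. \<lbrakk>x \<in> RN N; t \<in> {0..T}; y \<in> RN N; s \<in> {0..T}\<rbrakk> \<Longrightarrow>
    \<bar>f (x, t) - f (y, s)\<bar> \<le> H * sqrt ((norm_RN N (x - y))\<^sup>2 + (t - s)\<^sup>2) powr \<alpha>"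
proof -
  from assms obtain C where C: "\<forall>(x, t) \<in> QT_bar N T. \<forall>(y, s) \<in> QT_bar N T.
      \<bar>f (x, t) - f (y, s)\<bar> \<le> C * sqrt ((norm_RN N (x - y))\<^sup>2 + (t - s)\<^sup>2) powr \<alpha>"
    by (auto simp: Holder_QT_bar_def)
  show thesis
  proof (rule that[of "\<bar>C\<bar>"])
    fix x t y s assume "x \<in> RN N" "t \<in> {0..T}" "y \<in> RN N" "s \<in> {0..T}"
    then have "\<bar>f (x, t) - f (y, s)\<bar> \<le> C * sqrt ((norm_RN N (x - y))\<^sup>2 + (t - s)\<^sup>2) powr \<alpha>"
      using C by (fastforce simp: QT_bar_def)
    also have "\<dots> \<le> \<bar>C\<bar> * sqrt ((norm_RN N (x - y))\<^sup>2 + (t - s)\<^sup>2) powr \<alpha>"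
      by (intro mult_right_mono) auto
    finally show "\<bar>f (x, t) - f (y, s)\<bar> \<le> \<bar>C\<bar> * sqrt ((norm_RN N (x - y))\<^sup>2 + (t - s)\<^sup>2) powr \<alpha>" .
  qed simp
qed

text \<open>The penalty gives D \<le> sqrt (2 M \<epsilon>), so the Hoelder function varies by less
  than c between the two points. Moving its argument to the point of the other function leaves u > v
  at that single point, whose time must exceed d. The other time is within d of it, hence positive;
  this is where ordering on a whole initial strip enters.\<close>

lemma doubled_max_positive_times:
  fixes M \<epsilon> \<beta> \<eta> H c :: real
  assumes xy: "x \<in> RN N" "y \<in> RN N" and ts: "t \<in> {0..T}" "s \<in> {0..T}"
    and uM: "\<And>q. q \<in> QT_bar N T \<Longrightarrow> \<bar>u q\<bar> \<le> M" and vM: "\<And>q. q \<in> QT_bar N T \<Longrightarrow> \<bar>v q\<bar> \<le> M"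
    and pos: "0 < \<epsilon>" "0 \<le> \<beta>" "0 \<le> \<eta>" "0 \<le> H" "0 \<le> \<alpha>" "0 < c"
    and d: "0 < d" "d < T" and init: "\<And>x t. x \<in> RN N \<Longrightarrow> t \<in> {0..d} \<Longrightarrow> u (x, t) \<le> v (x, t)"
    and w: "w = u \<or> w = v"
    and Hw: "\<And>x t y s. \<lbrakk>x \<in> RN N; t \<in> {0..T}; y \<in> RN N; s \<in> {0..T}\<rbrakk> \<Longrightarrow>
      \<bar>w (x, t) - w (y, s)\<bar> \<le> H * sqrt ((norm_RN N (x - y))\<^sup>2 + (t - s)\<^sup>2) powr \<alpha>"
    and val: "c \<le> doubled N u v \<epsilon> \<eta> \<beta> a b x t y s"
    and small: "H * sqrt (2 * M * \<epsilon>) powr \<alpha> < c" "sqrt (2 * M * \<epsilon>) < d"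
  shows "t \<in> {0<..T}" "s \<in> {0<..T}"
proof -
  define D where "D = sqrt ((norm_RN N (x - y))\<^sup>2 + (t - s)\<^sup>2)"
  have D2: "D\<^sup>2 = (norm_RN N (x - y))\<^sup>2 + (t - s)\<^sup>2"
    by (simp add: D_def)
  have "0 \<le> \<beta> * (bump N a x + bump N b y)" "0 \<le> \<eta> * t"
    using pos ts bump_bounds(1)[of N a x] bump_bounds(1)[of N b y] by auto
  with val have le: "D\<^sup>2 / \<epsilon> + c \<le> u (x, t) - v (y, s)"
    by (simp add: doubled_def D2 add_divide_distrib)
  have "(x, t) \<in> QT_bar N T" "(y, s) \<in> QT_bar N T"
    using xy ts by (auto simp: QT_bar_def)
  from uM[OF this(1)] vM[OF this(2)] le pos have "D\<^sup>2 / \<epsilon> \<le> 2 * M"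
    by linarith
  then have "D\<^sup>2 \<le> 2 * M * \<epsilon>"
    using pos by (simp add: field_simps)
  then have D: "D \<le> sqrt (2 * M * \<epsilon>)"
    by (rule real_le_rsqrt)
  have D0: "0 \<le> D"
    by (simp add: D_def)
  have "H * D powr \<alpha> \<le> H * sqrt (2 * M * \<epsilon>) powr \<alpha>"
    using D D0 pos by (intro mult_left_mono powr_mono2) auto
  with small have HD: "H * D powr \<alpha> < c"
    by linarith
  have ws: "\<bar>w (x, t) - w (y, s)\<bar> \<le> H * D powr \<alpha>"
    unfolding D_def by (rule Hw) fact+
  have "c \<le> u (x, t) - v (y, s)"
    using le divide_nonneg_pos[OF zero_le_power2[of D] pos(1)] by linarith
  then have gap: "\<bar>w (x, t) - w (y, s)\<bar> < u (x, t) - v (y, s)"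
    using ws HD by linarith
  from w have late: "d < t \<or> d < s"
  proof
    assume "w = u"
    then have "v (y, s) < u (y, s)"
      using gap by simp
    then show ?thesis
      using init[OF xy(2), of s] ts by force
  next
    assume "w = v"
    then have "v (x, t) < u (x, t)"
      using gap by simp
    then show ?thesis
      using init[OF xy(1), of t] ts by force
  qed
  have "\<bar>t - s\<bar> \<le> D"
    unfolding D_def by (rule real_le_rsqrt) simp
  then have "\<bar>t - s\<bar> < d"
    using D small by linarith
  then have "0 < t" "0 < s"
    using late d by linarith+
  then show "t \<in> {0<..T}" "s \<in> {0<..T}"
    using ts by auto
qed

text \<open>A violation of size 4 c is budgeted: at most 2 c for \<eta> t with \<eta> = 2 c / T, at
  most c for the bumps, so the maximum is at least c. As \<eta> is fixed before \<epsilon>, the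
  estimate \<eta> \<le> \<omega> (C \<epsilon>^(1/4)) fails for small \<epsilon>.\<close>

lemma comparison:
  fixes \<kappa> A m n \<sigma> \<alpha> d T :: real and N :: nat
  assumes \<sigma>: "0 < \<sigma>" "\<sigma> \<le> 1" and n: "0 < n" and m: "1 < m"
    and A: "A = 2 / (1 + I_ind \<sigma> - \<sigma>)"
    and \<kappa>: "0 < \<kappa>" "\<kappa> < \<sigma>" "\<kappa> \<le> 1 / 2" "(A + 1 + m) * \<kappa> * n \<le> 1 / 4"
    and \<alpha>: "1 - \<kappa> < \<alpha>" "\<alpha> < 1" and T: "0 < T"
    and K: "admissible_kernel N \<sigma> K" and F: "degenerate_elliptic N F"
    and \<omega>: "modulus_of_continuity \<omega>" and str: "structure_condition N n m \<omega> F"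
    and u: "bounded (u ` QT_bar N T)" "usc_on (QT_bar N T) u" "viscosity_subsolution N \<sigma> K F T u"
    and v: "bounded (v ` QT_bar N T)" "lsc_on (QT_bar N T) v" "viscosity_supersolution N \<sigma> K F T v"
    and d: "0 < d" "d < T" and init: "\<And>x t. x \<in> RN N \<Longrightarrow> t \<in> {0..d} \<Longrightarrow> u (x, t) \<le> v (x, t)"
    and Holder: "Holder_QT_bar N T \<alpha> u \<or> Holder_QT_bar N T \<alpha> v"
    and q: "q \<in> QT_bar N T"
  shows "u q \<le> v q"
proof (rule ccontr)
  assume "\<not> u q \<le> v q"
  then obtain x0 t0 where q0: "q = (x0, t0)" "x0 \<in> RN N" "t0 \<in> {0..T}" and gap: "v q < u q"
    using q by (cases q) (auto simp: QT_bar_def)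
  define c where "c = (u q - v q) / 4"
  have c: "0 < c"
    using gap by (simp add: c_def)
  obtain Mu where Mu: "\<forall>q\<in>QT_bar N T. \<bar>u q\<bar> \<le> Mu"
    using u(1) by (auto simp: bounded_iff)
  obtain Mv where Mv: "\<forall>q\<in>QT_bar N T. \<bar>v q\<bar> \<le> Mv"
    using v(1) by (auto simp: bounded_iff)
  define M where "M = max Mu Mv"
  have uM: "\<bar>u q\<bar> \<le> M" and vM: "\<bar>v q\<bar> \<le> M" if "q \<in> QT_bar N T" for q
    using Mu Mv that by (fastforce simp: M_def)+
  obtain w where w: "w = u \<or> w = v" and "Holder_QT_bar N T \<alpha> w"
    using Holder by blast
  then obtain H where H: "0 \<le> H" and Hw: "\<And>x t y s. \<lbrakk>x \<in> RN N; t \<in> {0..T}; y \<in> RN N; s \<in> {0..T}\<rbrakk> \<Longrightarrow>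
      \<bar>w (x, t) - w (y, s)\<bar> \<le> H * sqrt ((norm_RN N (x - y))\<^sup>2 + (t - s)\<^sup>2) powr \<alpha>"
    using Holder_QT_barE by blast
  have Hx: "\<bar>w (x, t) - w (y, t)\<bar> \<le> H * norm_RN N (x - y) powr \<alpha>"
    if "x \<in> RN N" "y \<in> RN N" "t \<in> {0..T}" for x y t
    using Hw[OF that(1,3,2,3)] by simp
  obtain C where C: "0 \<le> C" and est: "\<And>\<epsilon> \<eta> a b x t y s.
    \<lbrakk>0 < \<epsilon>; \<epsilon> < 1; x \<in> RN N; y \<in> RN N; t \<in> {0<..T}; s \<in> {0<..T};
      \<And>x' t' y' s'. \<lbrakk>x' \<in> RN N; y' \<in> RN N; t' \<in> {0..T}; s' \<in> {0..T}\<rbrakk> \<Longrightarrow>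
        doubled N u v \<epsilon> \<eta> (\<epsilon> powr (A + 2)) a b x' t' y' s'
          \<le> doubled N u v \<epsilon> \<eta> (\<epsilon> powr (A + 2)) a b x t y s\<rbrakk>
    \<Longrightarrow> \<eta> \<le> \<omega> (C * \<epsilon> powr (1 / 4))"
    using comparison_estimate[OF \<sigma> n m A \<kappa> \<alpha> K F \<omega> str u(2,3) v(2,3) uM vM H w Hx] by blast
  have A0: "0 < A"
    using \<sigma> by (simp add: A I_ind_def)
  have \<alpha>0: "0 < \<alpha>"
    using \<alpha> \<kappa> by linarith
  define \<eta> where "\<eta> = 2 * c / T"
  have \<eta>: "0 < \<eta>"
    using c T by (simp add: \<eta>_def)
  have "\<forall>\<^sub>F r in at_right 0. \<omega> r < \<eta>"
    using \<omega> \<eta> unfolding modulus_of_continuity_def by (auto intro: order_tendstoD(2))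
  then obtain r0 where r0: "0 < r0" "\<And>r. 0 < r \<Longrightarrow> r < r0 \<Longrightarrow> \<omega> r < \<eta>"
    by (auto simp: eventually_at_right_field)
  \<comment> \<open>The filter \<open>at_right 0\<close> leaves out 0, which is the argument when C
    = 0; there \<omega> vanishes.\<close>
  have \<omega>_small: "\<omega> r < \<eta>" if "0 \<le> r" "r < r0" for r
    using that r0(2)[of r] \<omega> \<eta> by (cases "r = 0") (auto simp: modulus_of_continuity_def)
  have id0: "((\<lambda>\<epsilon>::real. \<epsilon>) \<longlongrightarrow> 0) (at_right 0)"
    by (rule tendsto_ident_at)
  have ev0: "\<forall>\<^sub>F \<epsilon>::real in at_right 0. 0 < \<epsilon>"
    by (rule eventually_at_right_less)
  have sq0: "((\<lambda>\<epsilon>. sqrt (2 * M * \<epsilon>)) \<longlongrightarrow> 0) (at_right 0)"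
    using tendsto_real_sqrt[OF tendsto_mult_right_zero[OF id0, of "2 * M"]] by simp
  have M0: "0 \<le> M"
    using uM[OF q] by linarith
  have "((\<lambda>\<epsilon>. sqrt (2 * M * \<epsilon>) powr \<alpha>) \<longlongrightarrow> 0) (at_right 0)"
  proof (rule tendsto_zero_powrI[OF sq0 tendsto_const _ \<alpha>0])
    show "\<forall>\<^sub>F \<epsilon> in at_right 0. 0 \<le> sqrt (2 * M * \<epsilon>)"
      using ev0 by eventually_elim (use M0 in auto)
  qed
  then have "((\<lambda>\<epsilon>. H * sqrt (2 * M * \<epsilon>) powr \<alpha>) \<longlongrightarrow> 0) (at_right 0)"
    by (rule tendsto_mult_right_zero)
  moreover have "((\<lambda>\<epsilon>::real. \<epsilon> powr (1 / 4)) \<longlongrightarrow> 0) (at_right 0)"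
  proof (rule tendsto_zero_powrI[OF id0 tendsto_const])
    show "\<forall>\<^sub>F \<epsilon>::real in at_right 0. 0 \<le> \<epsilon>"
      using ev0 by eventually_elim auto
  qed simp
  then have "((\<lambda>\<epsilon>. C * \<epsilon> powr (1 / 4)) \<longlongrightarrow> 0) (at_right 0)"
    by (rule tendsto_mult_right_zero)
  moreover have "((\<lambda>\<epsilon>. 2 * real N * \<epsilon>) \<longlongrightarrow> 0) (at_right 0)"
    by (rule tendsto_mult_right_zero[OF id0])
  ultimately have "\<forall>\<^sub>F \<epsilon> in at_right 0. 0 < \<epsilon> \<and> \<epsilon> < 1 \<and> sqrt (2 * M * \<epsilon>) < d \<and>
      H * sqrt (2 * M * \<epsilon>) powr \<alpha> < c \<and> C * \<epsilon> powr (1 / 4) < r0 \<and> 2 * real N * \<epsilon> < c"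
    using ev0 order_tendstoD(2)[OF id0, of 1] order_tendstoD(2)[OF sq0 d(1)] c r0(1)
    by (intro eventually_conj) (auto intro: order_tendstoD(2))
  then obtain \<epsilon> where \<epsilon>: "0 < \<epsilon>" "\<epsilon> < 1" and small: "sqrt (2 * M * \<epsilon>) < d"
      "H * sqrt (2 * M * \<epsilon>) powr \<alpha> < c" "C * \<epsilon> powr (1 / 4) < r0" "2 * real N * \<epsilon> < c"
    using eventually_happens'[OF trivial_limit_at_right_real] by blast
  define \<beta> where "\<beta> = \<epsilon> powr (A + 2)"
  have "\<beta> \<le> \<epsilon> powr 1"
    unfolding \<beta>_def using A0 \<epsilon> by (intro powr_mono') auto
  then have \<beta>: "0 < \<beta>" "\<beta> \<le> \<epsilon>"
    using \<epsilon> by (auto simp: \<beta>_def)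
  obtain a b x t y s where xy: "x \<in> RN N" "y \<in> RN N" and ts: "t \<in> {0..T}" "s \<in> {0..T}"
    and max: "\<And>x' t' y' s'. \<lbrakk>x' \<in> RN N; y' \<in> RN N; t' \<in> {0..T}; s' \<in> {0..T}\<rbrakk> \<Longrightarrow>
      doubled N u v \<epsilon> \<eta> \<beta> a b x' t' y' s' \<le> doubled N u v \<epsilon> \<eta> \<beta> a b x t y s"
  proof (rule doubled_attains_max[OF u(2) v(2) uM vM T \<epsilon>(1) \<beta>(1) less_imp_le[OF \<eta>]])
    fix a b x t y s
    assume "x \<in> RN N" "y \<in> RN N" "t \<in> {0..T}" "s \<in> {0..T}"
      and "\<And>x' t' y' s'. \<lbrakk>x' \<in> RN N; y' \<in> RN N; t' \<in> {0..T}; s' \<in> {0..T}\<rbrakk> \<Longrightarrow>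
        doubled N u v \<epsilon> \<eta> \<beta> a b x' t' y' s' \<le> doubled N u v \<epsilon> \<eta> \<beta> a b x t y s"
    then show thesis
      by (rule that)
  qed
  have "c \<le> doubled N u v \<epsilon> \<eta> \<beta> a b x0 t0 x0 t0"
  proof -
    have "\<eta> * t0 \<le> \<eta> * T"
      using \<eta> q0 by (intro mult_left_mono) auto
    then have "\<eta> * t0 \<le> 2 * c"
      using T by (simp add: \<eta>_def)
    moreover have "\<beta> * (bump N a x0 + bump N b x0) \<le> \<epsilon> * (real N + real N)"
      using \<beta> \<epsilon> bump_bounds by (intro mult_mono add_mono) (auto intro: add_nonneg_nonneg)
    moreover have "u (x0, t0) - v (x0, t0) = 4 * c"
      by (simp add: c_def q0(1))
    ultimately show ?thesis
      using small(4) by (simp add: doubled_def algebra_simps)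
  qed
  also have "\<dots> \<le> doubled N u v \<epsilon> \<eta> \<beta> a b x t y s"
    using q0 by (intro max)
  finally have val: "c \<le> doubled N u v \<epsilon> \<eta> \<beta> a b x t y s" .
  note times = doubled_max_positive_times[OF xy ts uM vM \<epsilon>(1) less_imp_le[OF \<beta>(1)]
      less_imp_le[OF \<eta>] H less_imp_le[OF \<alpha>0] c d init w Hw val small(2,1)]
  have "\<eta> \<le> \<omega> (C * \<epsilon> powr (1 / 4))"
    by (rule est[OF \<epsilon> xy times max[unfolded \<beta>_def]])
  moreover have "\<omega> (C * \<epsilon> powr (1 / 4)) < \<eta>"
    using C small(3) by (intro \<omega>_small) auto
  ultimately show False
    by simp
qed

theorem proposition3p1:
  fixes \<sigma> n m :: real
  assumes "0 < \<sigma>" and "\<sigma> \<le> 1" and "n > 0" and "m > 1"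
  shows "\<exists>\<alpha>\<^sub>0<1. \<forall>N\<ge>1. \<forall>T>0.
    \<forall>(K :: vec \<Rightarrow> real) (F :: vec \<Rightarrow> vec \<Rightarrow> real \<Rightarrow> real) (\<omega> :: real \<Rightarrow> real)
     (u :: point \<Rightarrow> real) (v :: point \<Rightarrow> real) (d\<^sub>0 :: real) (\<alpha> :: real).
      admissible_kernel N \<sigma> K \<longrightarrow>
      continuous_on (RN N \<times> RN N \<times> UNIV) (\<lambda>(x, p, l). F x p l) \<longrightarrow>
      degenerate_elliptic N F \<longrightarrow>
      modulus_of_continuity \<omega> \<longrightarrow>
      structure_condition N n m \<omega> F \<longrightarrow>
      bounded (u ` QT_bar N T) \<longrightarrow> usc_on (QT_bar N T) u \<longrightarrow>
      bounded (v ` QT_bar N T) \<longrightarrow> lsc_on (QT_bar N T) v \<longrightarrow>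
      viscosity_subsolution N \<sigma> K F T u \<longrightarrow>
      viscosity_supersolution N \<sigma> K F T v \<longrightarrow>
      0 < d\<^sub>0 \<longrightarrow> d\<^sub>0 < T \<longrightarrow>
      (\<forall>x\<in>RN N. \<forall>t\<in>{0..d\<^sub>0}. u (x, t) \<le> v (x, t)) \<longrightarrow>
      \<alpha>\<^sub>0 < \<alpha> \<longrightarrow> \<alpha> < 1 \<longrightarrow>
      Holder_QT_bar N T \<alpha> u \<or> Holder_QT_bar N T \<alpha> v \<longrightarrow>
      (\<forall>q \<in> QT_bar N T. u q \<le> v q)"
proof -
  define A where "A = 2 / (1 + I_ind \<sigma> - \<sigma>)"
  have "0 < 1 + I_ind \<sigma> - \<sigma>"
    using assms by (auto simp: I_ind_def)
  then have D: "0 < A + 1 + m"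
    using assms by (simp add: A_def add_pos_pos)
  \<comment> \<open>The first bound gives \<kappa> < \<sigma> and \<kappa> \<le> 1/2, the second the
    growth exponent 1/4. Only \<sigma>, n and m occur, so the threshold 1 - \<kappa> can be chosen
    before N.\<close>
  define \<kappa> where "\<kappa> = min (\<sigma> / 2) (1 / (4 * n * (A + 1 + m)))"
  have \<kappa>: "0 < \<kappa>" "\<kappa> < \<sigma>" "\<kappa> \<le> 1 / 2"
    using assms D by (auto simp: \<kappa>_def min_less_iff_disj min_le_iff_disj)
  have "(A + 1 + m) * \<kappa> * n \<le> (A + 1 + m) * (1 / (4 * n * (A + 1 + m))) * n"
    using assms D by (intro mult_right_mono mult_left_mono) (auto simp: \<kappa>_def)
  also have "\<dots> = 1 / 4"
    using assms D by (simp del: distrib_left_numeral)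
  finally have \<kappa>4: "(A + 1 + m) * \<kappa> * n \<le> 1 / 4" .
  show ?thesis
  proof (intro exI[of _ "1 - \<kappa>"] conjI allI impI ballI)
    show "1 - \<kappa> < 1"
      using \<kappa> by simp
  next
    fix N T K F \<omega> u v d \<alpha> q
    assume *: "0 < T" "admissible_kernel N \<sigma> K" "degenerate_elliptic N F" "modulus_of_continuity \<omega>"
      "structure_condition N n m \<omega> F" "bounded (u ` QT_bar N T)" "usc_on (QT_bar N T) u"
      "bounded (v ` QT_bar N T)" "lsc_on (QT_bar N T) v" "viscosity_subsolution N \<sigma> K F T u"
      "viscosity_supersolution N \<sigma> K F T v" "0 < d" "d < T"
      "\<forall>x\<in>RN N. \<forall>t\<in>{0..d}. u (x, t) \<le> v (x, t)" "1 - \<kappa> < \<alpha>" "\<alpha> < 1"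
      "Holder_QT_bar N T \<alpha> u \<or> Holder_QT_bar N T \<alpha> v" "q \<in> QT_bar N T"
    show "u q \<le> v q"
      by (rule comparison[OF assms A_def \<kappa> \<kappa>4 *(15,16,1-7,10,8,9,11-13) _ *(17,18)])
        (use *(14) in blast)
  qed
qed

end
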